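(* Let $0<\beta<1$ and $p=\lceil\beta^{-1}\rceil-1$. Let $G$ be a $K_{p+2}$-free graph of order $n$ with minimum degree $(1-\beta)n$ (where $(1-\beta)n$ is an integer). Then $$\frac{k_s(G)}{g_s(\beta)n^s}\ge\frac{k_t(G)}{g_t(\beta)n^t}$$ for all integers $2\le t<s\le p+1$. Moreover, the following are equivalent: (i) equality holds for some $2\le t<s\le p+1$; (ii) equality holds for all $2\le t<s\le p+1$; (iii) $(n,\beta)$ is feasible and $G\in\mathcal{G}(n,\beta)$.
   Context: All graphs are finite and simple; $k_r(G)$ is the number of $r$-cliques of $G$. For $0<\beta<1$, $p=\lceil\beta^{-1}\rceil-1$ and integers $r$, define $$g_r(\beta)=\binom{p-1}{r}\beta^{r}+\binom{p-1}{r-1}(1-(p-1)\beta)\beta^{r-1}+\frac12\binom{p-1}{r-2}(1-p\beta)(1-(p-1)\beta)\beta^{r-2},$$ where $\binom{x}{y}=0$ if $x<y$ or $y<0$. The family $\mathcal{G}(n,\beta)$ (defined only when $n$ and $(1-\beta)n$ are positive integers not both odd) consists of all graphs $G$ on vertex set $V$, $|V|=n$, admitting a partition $V=V_0\cup V_1\cup\dots\cup V_{p-1}$ with $|V_0|=(1-(p-1)\beta)n$ and $|V_i|=\beta n$ for $1\le i\le p-1$, such that: all edges between $V_i$ and $V_j$ are present for $0\le i<j\le p-1$; $V_i$ is independent for $1\le i\le p-1$; and $G[V_0]$ is $(1-p\beta)n$-regular with minimum number of triangles among all $(1-p\beta)n$-regular graphs on $|V_0|$ vertices. The pair $(n,\beta)$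 is feasible if $\mathcal{G}(n,\beta)$ is defined and $G[V_0]$ is triangle-free for $G\in\mathcal{G}(n,\beta)$.
   Formalization: The equivalence of (i), (ii), (iii) is stated for p ≥ 2 only; for p = 1 there are no integers 2 ≤ t < s ≤ p+1, so (i) is false and (ii) vacuously true (e.g. the 4-cycle with β = 1/2), and the equivalence fails. *)

theory Defs
  imports Complex_Main
begin

definition graph :: "'a set \<Rightarrow> 'a set set \<Rightarrow> bool" where
  "graph V E \<longleftrightarrow> finite V \<and> (\<forall>e\<in>E. e \<subseteq> V \<and> card e = 2)"

definition nbrs :: "'a set \<Rightarrow> 'a set set \<Rightarrow> 'a \<Rightarrow> 'a set" where
  "nbrs V E v = {u\<in>V. {u, v} \<in> E}"

definition degree :: "'a set \<Rightarrow> 'a set set \<Rightarrow> 'a \<Rightarrow> nat" where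
  "degree V E v = card (nbrs V E v)"

definition min_degree_eq :: "'a set \<Rightarrow> 'a set set \<Rightarrow> nat \<Rightarrow> bool" where
  "min_degree_eq V E d \<longleftrightarrow> (\<forall>v\<in>V. d \<le> degree V E v) \<and> (\<exists>v\<in>V. degree V E v = d)"

definition clique :: "'a set \<Rightarrow> 'a set set \<Rightarrow> 'a set \<Rightarrow> bool" where
  "clique V E S \<longleftrightarrow> S \<subseteq> V \<and> (\<forall>u\<in>S. \<forall>v\<in>S. u \<noteq> v \<longrightarrow> {u, v} \<in> E)"

definition kcl :: "nat \<Rightarrow> 'a set \<Rightarrow> 'a set set \<Rightarrow> nat" where
  "kcl r V E = card {S. clique V E S \<and> card S = r}"

definition induced :: "'a set set \<Rightarrow> 'a set \<Rightarrow> 'a set set" where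
  "induced E W = {e\<in>E. e \<subseteq> W}"

definition regular :: "'a set \<Rightarrow> 'a set set \<Rightarrow> real \<Rightarrow> bool" where
  "regular V E d \<longleftrightarrow> (\<forall>v\<in>V. real (degree V E v) = d)"

definition pp :: "real \<Rightarrow> nat" where
  "pp \<beta> = nat (\<lceil>1 / \<beta>\<rceil> - 1)"

definition binom :: "int \<Rightarrow> int \<Rightarrow> real" where
  "binom x y = (if y < 0 \<or> x < y then 0 else real (nat x choose nat y))"

definition g :: "nat \<Rightarrow> real \<Rightarrow> real" where
  "g r \<beta> = (let p = int (pp \<beta>) in
      binom (p - 1) (int r) * \<beta> ^ r
    + binom (p - 1) (int r - 1) * (1 - (real_of_int p - 1) * \<beta>) * \<beta> powi (int r - 1)
    + 1/2 * binom (p - 1) (int r - 2) * (1 - real_of_int p * \<beta>)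
        * (1 - (real_of_int p - 1) * \<beta>) * \<beta> powi (int r - 2))"

definition min_tri_regular :: "'a set \<Rightarrow> 'a set set \<Rightarrow> real \<Rightarrow> bool" where
  "min_tri_regular W F d \<longleftrightarrow> regular W F d \<and>
     (\<forall>H. graph {0..<card W} H \<and> regular {0..<card W} H d
          \<longrightarrow> kcl 3 W F \<le> kcl 3 {0..<card W} H)"

definition family_defined :: "nat \<Rightarrow> real \<Rightarrow> bool" where
  "family_defined n \<beta> \<longleftrightarrow> n > 0 \<and>
     (\<exists>k::nat. k > 0 \<and> real k = (1 - \<beta>) * real n \<and> \<not> (odd n \<and> odd k))"

definition in_family :: "'a set \<Rightarrow> 'a set set \<Rightarrow> nat \<Rightarrow> real \<Rightarrow> bool" where
  "in_family V E n \<beta> \<longleftrightarrow> family_defined n \<beta> \<and> graph V E \<and> card V = n \<and>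
     (let p = pp \<beta> in
      \<exists>P :: nat \<Rightarrow> 'a set.
        (\<Union>i<p. P i) = V \<and>
        (\<forall>i<p. \<forall>j<p. i \<noteq> j \<longrightarrow> P i \<inter> P j = {}) \<and>
        real (card (P 0)) = (1 - (real p - 1) * \<beta>) * real n \<and>
        (\<forall>i. 1 \<le> i \<and> i < p \<longrightarrow> real (card (P i)) = \<beta> * real n) \<and>
        (\<forall>i<p. \<forall>j<p. i \<noteq> j \<longrightarrow> (\<forall>u\<in>P i. \<forall>v\<in>P j. {u, v} \<in> E)) \<and>
        (\<forall>i. 1 \<le> i \<and> i < p \<longrightarrow> (\<forall>u\<in>P i. \<forall>v\<in>P i. {u, v} \<notin> E)) \<and>
        min_tri_regular (P 0) (induced E (P 0)) ((1 - real p * \<beta>) * real n))"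

(* (n,beta) feasible: G(n,beta) defined and G[V0] triangle-free for all members,
   i.e. every triangle-minimising (1-p beta)n-regular graph on |V0| vertices is
   triangle-free *)
definition feasible :: "nat \<Rightarrow> real \<Rightarrow> bool" where
  "feasible n \<beta> \<longleftrightarrow> family_defined n \<beta> \<and>
     (\<forall>m::nat. real m = (1 - (real (pp \<beta>) - 1) * \<beta>) * real n \<longrightarrow>
        (\<forall>H. graph {0..<m} H \<and> min_tri_regular {0..<m} H ((1 - real (pp \<beta>) * \<beta>) * real n)
             \<longrightarrow> kcl 3 {0..<m} H = 0))"

end

theory Submission
  imports Defs
begin

text \<open>
  Put \<open>b = \<beta>n\<close> and let \<open>D(T)\<close> be the number of common neighbours of a clique \<open>T\<close>. In a \<open>K\<^bsub>p+2\<^esub>\<close>-free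
  graph of minimum degree \<open>n - b\<close> every \<open>t\<close>-clique satisfies \<open>n - tb \<le> D(T) \<le> (p+1-t)b\<close>, while counting
  the neighbours of all vertices in an \<open>s\<close>-clique \<open>S\<close> gives
  \<open>\<Sum>v\<in>S. D(S - v) \<ge> 2n - sb + (s-2)D(S)\<close>. Summing the latter over all \<open>(t+1)\<close>-cliques produces
  \<open>\<Sum>T. D(T)\<^sup>2\<close>, which the former bounds by a linear expression, so that
  \<open>A k\<^sub>t + C k\<^bsub>t+2\<^esub> \<le> B k\<^bsub>t+1\<^esub>\<close> with explicit coefficients. The numbers \<open>g\<^sub>t(\<beta>)n\<^sup>t\<close> satisfy the same
  recurrence with equality, and downward induction from \<open>k\<^bsub>p+2\<^esub> = 0\<close> gives the monotonicity of the ratios.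

  Equality for one pair propagates upwards to \<open>(p, p+1)\<close>. There it forces, for each \<open>(p+1)\<close>-clique \<open>S\<close>,
  all degrees in \<open>S\<close> to be \<open>n - b\<close> and \<open>D(S - v) = b\<close> for at least \<open>p - 1\<close> vertices \<open>v\<close>; the common
  neighbourhoods of these \<open>S - v\<close> are the independent classes \<open>V\<^sub>1, \<dots>, V\<^bsub>p-1\<^esub>\<close>. Conversely, in such a
  graph each \<open>D(T)\<close> is at one end of its interval, so all inequalities are equalities.\<close>

section \<open>The polynomials \<open>g\<close>\<close>

text \<open>With \<open>b = \<beta>n\<close> and \<open>p = q + 1\<close> this is \<open>g (j+2) \<beta> * n^(j+2)\<close>; the shift by 2 avoids
  truncated subtraction.\<close>
definition Gpoly :: "nat \<Rightarrow> real \<Rightarrow> real \<Rightarrow> nat \<Rightarrow> real" where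
  "Gpoly q n b j = real (q choose (j+2)) * b^(j+2) + real (q choose (j+1)) * (n - real q * b) * b^(j+1)
     + 1/2 * real (q choose j) * (n - real q * b) * (n - real (q+1) * b) * b^j"

text \<open>Working over the reals lets the factor \<open>q - j\<close> become negative, so no case
  distinction on \<open>j <= q\<close> is necessary: beyond that range both binomials
  vanish.\<close>

lemma choose_Suc_real: "(real j + 1) * real (q choose Suc j) = (real q - real j) * real (q choose j)"
  using gbinomial_mult_1[of "real q" j] by (simp add: binomial_gbinomial algebra_simps)

text \<open>These are the coefficients that double counting produces for clique numbers at
  \<open>t = j + 2\<close> and \<open>p = q + 1\<close>, see \<open>gap_identity\<close>; here the
  recurrence is exact.\<close>

lemma Gpoly_recurrence:
  "(n - real (j+2) * b) * (real q - real j) * b * Gpoly q n b j + real (j+1) * real (j+4) * Gpoly q n b (j+2)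
   = (real (j+1) * n + real (j+3) * (real q - 1 - 2 * real j) * b) * Gpoly q n b (j+1)"
proof -
  define x where "x = real j"
  define y where "y = real q"
  have x: "x \<ge> 0" by (simp add: x_def)
  \<comment> \<open>dividing by all denominators at once makes the recurrence a polynomial identity in \<open>x\<close>, \<open>y\<close>, \<open>e\<close>\<close>
  define e where "e = real (q choose j) / ((x+1)*(x+2)*(x+3)*(x+4))"
  have c0: "real (q choose j) = (x+1)*(x+2)*(x+3)*(x+4)*e"
    using x by (simp add: e_def)
  have "(x+1) * real (q choose (j+1)) = (x+1) * ((y-x)*(x+2)*(x+3)*(x+4)*e)"
    using choose_Suc_real[of j q] c0 by (simp add: x_def y_def algebra_simps)
  hence c1: "real (q choose (j+1)) = (y-x)*(x+2)*(x+3)*(x+4)*e"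
    using x by simp
  have "(x+2) * real (q choose (j+2)) = (y-(x+1)) * real (q choose (j+1))"
    using choose_Suc_real[of "j+1" q] by (simp add: x_def y_def algebra_simps numeral_eq_Suc)
  also have "\<dots> = (x+2) * ((y-x)*(y-x-1)*(x+3)*(x+4)*e)" 
    unfolding c1 by (simp add: algebra_simps)
  finally have c2: "real (q choose (j+2)) = (y-x)*(y-x-1)*(x+3)*(x+4)*e"
    using x by simp
  have "(x+3) * real (q choose (j+3)) = (y-(x+2)) * real (q choose (j+2))"
    using choose_Suc_real[of "j+2" q] by (simp add: x_def y_def algebra_simps numeral_eq_Suc)
  also have "\<dots> = (x+3) * ((y-x)*(y-x-1)*(y-x-2)*(x+4)*e)" 
    unfolding c2 by (simp add: algebra_simps)
  finally have c3: "real (q choose (j+3)) = (y-x)*(y-x-1)*(y-x-2)*(x+4)*e"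
    using x by simp
  have "(x+4) * real (q choose (j+4)) = (y-(x+3)) * real (q choose (j+3))"
    using choose_Suc_real[of "j+3" q] by (simp add: x_def y_def algebra_simps numeral_eq_Suc)
  also have "\<dots> = (x+4) * ((y-x)*(y-x-1)*(y-x-2)*(y-x-3)*e)" 
    unfolding c3 by (simp add: algebra_simps)
  finally have c4: "real (q choose (j+4)) = (y-x)*(y-x-1)*(y-x-2)*(y-x-3)*e"
    using x by simp
  define z where "z = b^j"
  \<comment> \<open>Doubling clears the factor 1/2. That constant is renamed \<open>h\<close> with
    \<open>2 * h = 1\<close>, so that \<open>algebra\<close> sees a purely polynomial goal.\<close>
  have P: "2 * Gpoly q n b k = 2 * real (q choose (k+2)) * (b * b * b^k) + 2 * real (q choose (k+1)) * (n-y*b) * (b * b^k)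
      + real (q choose k) * (n-y*b) * (n-(y+1)*b) * b^k" for k
  proof -
    have y1: "real (q+1) = y + 1" by (simp add: y_def)
    define h :: real where "h = 1/2"
    hence h: "1/2 = h" "2 * h = 1" by simp_all
    define w where "w = b^k"
    have w: "b^(k+1) = b * w" "b^(k+2) = b * b * w" by (simp_all add: w_def)
    show ?thesis unfolding Gpoly_def y1 y_def[symmetric] w w_def[symmetric] h(1) using h(2) by algebra
  qed
  have s: "j+1+1 = j+2" "j+1+2 = j+3" "j+2+1 = j+3" "j+2+2 = j+4" by auto
  have z: "b^(j+1) = b * z" "b^(j+2) = b*b*z" by (simp_all add: z_def)
  have G0: "2 * Gpoly q n b j = z * e * (x+3)*(x+4)*(2*(y-x)*(y-x-1)*b^2 + 2*(y-x)*(x+2)*(n-y*b)*b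
      + (x+1)*(x+2)*(n-y*b)*(n-(y+1)*b))"
    unfolding P c0 c1 c2 z_def[symmetric] by algebra
  have G1: "2 * Gpoly q n b (j+1) = z * e * (x+4)*(y-x)*b*(2*(y-x-1)*(y-x-2)*b^2 + 2*(y-x-1)*(x+3)*(n-y*b)*b
      + (x+2)*(x+3)*(n-y*b)*(n-(y+1)*b))"
    unfolding P s z c1 c2 c3 by algebra
  have G2: "2 * Gpoly q n b (j+2) = z * e * (y-x)*(y-x-1)*b^2*(2*(y-x-2)*(y-x-3)*b^2 + 2*(y-x-2)*(x+4)*(n-y*b)*b
      + (x+3)*(x+4)*(n-y*b)*(n-(y+1)*b))"
    unfolding P s z c2 c3 c4 by algebra
  have r: "real (j+2) = x+2" "real (j+1) = x+1" "real (j+4) = x+4" "real (j+3) = x+3" by (auto simp: x_def)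
  have "(n - (x+2) * b) * (y - x) * b * (2 * Gpoly q n b j) + (x+1) * (x+4) * (2 * Gpoly q n b (j+2))
   = ((x+1) * n + (x+3) * (y - 1 - 2 * x) * b) * (2 * Gpoly q n b (j+1))"
    unfolding G0 G1 G2 by algebra
  thus ?thesis unfolding r x_def[symmetric] y_def[symmetric] by algebra
qed

text \<open>The last summand is strictly positive as soon as \<open>j <= q\<close>; the other two
  may vanish but are nonnegative.\<close>

lemma Gpoly_pos:
  assumes "j \<le> q" "0 < b" "real (q+1) * b < n"
  shows "0 < Gpoly q n b j"
proof -
  have "real q * b \<le> real (q+1) * b" using assms(2) by (simp add: algebra_simps)
  hence *: "n - real q * b > 0" "n - real (q+1) * b > 0" using assms(3) by linarith+
  have "0 < real (q choose j)" using assms(1) by simp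
  hence "0 < 1/2 * real (q choose j) * (n - real q * b) * (n - real (q+1) * b) * b^j"
    using * assms(2) by simp
  moreover have "0 \<le> real (q choose (j+2)) * b^(j+2)"
     "0 \<le> real (q choose (j+1)) * (n - real q * b) * b^(j+1)"
    using * assms(2) by simp_all
  ultimately show ?thesis unfolding Gpoly_def by linarith
qed

text \<open>After the shift by 2 all exponents and lower binomial indices in \<open>g\<close> are
  natural numbers, so \<open>powi\<close> and \<open>binom\<close> reduce to ordinary powers and
  binomial coefficients.\<close>

lemma g_conv_Gpoly:
  assumes "pp \<beta> = Suc q" "n > 0"
  shows "g (j+2) \<beta> * n ^ (j+2) = Gpoly q n (\<beta> * n) j"
proof -
  have b: "binom (int q) (int k) = real (q choose k)" for k
    by (auto simp: binom_def binomial_eq_0)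
  have p: "\<beta> powi (int k) = \<beta> ^ k" for k by simp
  have e: "int (j+2) - 1 = int (j+1)" "int (j+2) - 2 = int j" "int (Suc q) - 1 = int q" by auto
  have r: "real_of_int (int (Suc q)) - 1 = real q" "real_of_int (int (Suc q)) = real (q+1)" by auto
  show ?thesis
    unfolding g_def Let_def assms(1) e b p r Gpoly_def
    by (simp add: algebra_simps power_add power_mult_distrib power2_eq_square)
qed

section \<open>Common neighbourhoods of cliques\<close>

text \<open>The empty set has all of \<open>V\<close> as its common neighbourhood, which starts the
  induction in \<open>cnbrs_ge\<close>.\<close>

definition cnbrs :: "'a set \<Rightarrow> 'a set set \<Rightarrow> 'a set \<Rightarrow> 'a set" where
  "cnbrs V E T = {v\<in>V. \<forall>u\<in>T. {u, v} \<in> E}"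

definition cliques :: "nat \<Rightarrow> 'a set \<Rightarrow> 'a set set \<Rightarrow> 'a set set" where
  "cliques t V E = {S. clique V E S \<and> card S = t}"

lemma kcl_eq_card_cliques: "kcl t V E = card (cliques t V E)"
  by (simp add: kcl_def cliques_def)

locale fin_graph =
  fixes V :: "'a set" and E :: "'a set set"
  assumes graph: "graph V E"
begin

lemma finite_V: "finite V"
  using graph by (simp add: graph_def)

lemma not_loop: "{v, v} \<notin> E"
  using graph by (auto simp: graph_def)

lemma edge_ends: "{u, v} \<in> E \<Longrightarrow> u \<in> V \<and> v \<in> V \<and> u \<noteq> v"
  using graph by (auto simp: graph_def)

lemma finite_cliques [simp]: "finite (cliques t V E)"
  by (rule finite_subset[of _ "Pow V"]) (auto simp: cliques_def clique_def finite_V)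

lemma finite_cnbrs [simp]: "finite (cnbrs V E T)"
  by (simp add: cnbrs_def finite_V)

lemma cliquesD: "S \<in> cliques t V E \<Longrightarrow> clique V E S" "S \<in> cliques t V E \<Longrightarrow> card S = t"
  by (auto simp: cliques_def)

lemma clique_finite: "clique V E S \<Longrightarrow> finite S"
  using finite_V by (auto simp: clique_def intro: finite_subset)

lemma clique_subset: "clique V E S \<Longrightarrow> T \<subseteq> S \<Longrightarrow> clique V E T"
  by (auto simp: clique_def)

lemma cnbrs_notin: "v \<in> cnbrs V E T \<Longrightarrow> v \<notin> T"
  using not_loop by (auto simp: cnbrs_def)

lemma clique_insert: "clique V E T \<Longrightarrow> v \<in> cnbrs V E T \<Longrightarrow> clique V E (insert v T)"
  by (auto simp: clique_def cnbrs_def insert_commute)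

lemma clique_remove: "clique V E S \<Longrightarrow> v \<in> S \<Longrightarrow> v \<in> cnbrs V E (S - {v})"
  by (auto simp: clique_def cnbrs_def)

lemma insert_cliques: "T \<in> cliques t V E \<Longrightarrow> v \<in> cnbrs V E T \<Longrightarrow> insert v T \<in> cliques (Suc t) V E"
  using clique_insert[of T v] cnbrs_notin[of v T] clique_finite[of T] by (auto simp: cliques_def)

lemma remove_cliques: "S \<in> cliques (Suc t) V E \<Longrightarrow> v \<in> S \<Longrightarrow> S - {v} \<in> cliques t V E"
  using clique_subset[of S "S - {v}"] clique_finite by (auto simp: cliques_def)

text \<open>Pairs of a \<open>t\<close>-clique \<open>T\<close> and a common neighbour
  \<open>v\<close> correspond to pairs of a \<open>(t+1)\<close>-clique \<open>S\<close> and a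
  vertex \<open>v\<close> of it, via \<open>S = insert v T\<close>. The weight 1 yields clique
  counts, the weight \<open>D\<close> yields the sum of squared codegrees.\<close>

lemma sum_extensions:
  fixes f :: "'a set \<Rightarrow> real"
  shows "(\<Sum>T\<in>cliques t V E. real (card (cnbrs V E T)) * f T) = (\<Sum>S\<in>cliques (Suc t) V E. \<Sum>v\<in>S. f (S - {v}))"
proof -
  have "(\<Sum>T\<in>cliques t V E. real (card (cnbrs V E T)) * f T) = (\<Sum>T\<in>cliques t V E. \<Sum>v\<in>cnbrs V E T. f T)"
    by simp
  also have "\<dots> = (\<Sum>(T,v)\<in>(SIGMA T:cliques t V E. cnbrs V E T). f T)"
    by (rule sum.Sigma) auto
  also have "\<dots> = (\<Sum>(S,v)\<in>(SIGMA S:cliques (Suc t) V E. S). f (S - {v}))"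
    by (rule sum.reindex_bij_witness[where j = "\<lambda>(T,v). (insert v T, v)" and i = "\<lambda>(S,v). (S - {v}, v)"])
       (auto simp: insert_cliques remove_cliques clique_remove[OF cliquesD(1)] dest: cnbrs_notin)
  also have "\<dots> = (\<Sum>S\<in>cliques (Suc t) V E. \<Sum>v\<in>S. f (S - {v}))"
    by (rule sum.Sigma[symmetric]) (auto dest: cliquesD intro: clique_finite)
  finally show ?thesis .
qed

lemma sum_card_cnbrs:
  "(\<Sum>T\<in>cliques t V E. real (card (cnbrs V E T))) = real (t+1) * real (kcl (t+1) V E)"
  using sum_extensions[where t = t and f = "\<lambda>_. 1"]
  by (simp add: kcl_eq_card_cliques) (simp add: cliques_def)

lemma degree_eq_card_cnbrs: "degree V E v = card (cnbrs V E {v})"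
  by (simp add: degree_def nbrs_def cnbrs_def insert_commute)

lemma cnbrs_insert_superset: "cnbrs V E T \<subseteq> cnbrs V E (insert v T) \<union> (V - nbrs V E v)"
  by (auto simp: cnbrs_def nbrs_def insert_commute)

lemma card_non_nbrs: "card (V - nbrs V E v) = card V - degree V E v" "degree V E v \<le> card V"
  using finite_V by (auto simp: degree_def nbrs_def card_Diff_subset intro!: card_mono)

text \<open>Counts, for each \<open>x\<close>, how many \<open>v\<in>S\<close> have \<open>x\<close> as a common neighbour of \<open>S - {v}\<close>;
  this is at least \<open>i - (s - 2)\<close> where \<open>i\<close> is the number of neighbours of \<open>x\<close> in \<open>S\<close>.\<close>
lemma sum_card_cnbrs_remove:
  assumes "clique V E S" "card S = s"
  shows sum_card_cnbrs_remove_ge: "(\<Sum>v\<in>S. real (card (cnbrs V E (S - {v})))) \<ge>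
      (\<Sum>v\<in>S. real (degree V E v)) - (real s - 2) * real (card V) + (real s - 2) * real (card (cnbrs V E S))"
    and sum_card_cnbrs_remove_eq: "(\<And>x. x \<in> V \<Longrightarrow> s \<le> card {v\<in>S. {v,x} \<in> E} + 2) \<Longrightarrow>
      (\<Sum>v\<in>S. real (card (cnbrs V E (S - {v})))) =
      (\<Sum>v\<in>S. real (degree V E v)) - (real s - 2) * real (card V) + (real s - 2) * real (card (cnbrs V E S))"
proof -
  have fS: "finite S" and SV: "S \<subseteq> V" using assms(1) clique_finite[OF assms(1)] by (auto simp: clique_def)
  define ind where "ind = (\<lambda>P. if P then 1 else 0 :: real)"
  have cc: "real (card {x\<in>V. P x}) = (\<Sum>x\<in>V. ind (P x))" for P
    using sum.inter_filter[OF finite_V, of "\<lambda>_. 1::real" P] by (simp add: ind_def)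
  define i where "i = (\<lambda>x. card {v\<in>S. {v,x} \<in> E})"
  define h where "h = (\<lambda>x. \<Sum>v\<in>S. ind (\<forall>u\<in>S-{v}. {u,x} \<in> E))"
  define w where "w = (\<lambda>x. ind (\<forall>u\<in>S. {u,x} \<in> E))"
  have L: "(\<Sum>v\<in>S. real (card (cnbrs V E (S - {v})))) = (\<Sum>x\<in>V. h x)"
    unfolding cnbrs_def cc h_def by (rule sum.swap)
  have W: "real (card (cnbrs V E S)) = (\<Sum>x\<in>V. w x)"
    unfolding cnbrs_def cc w_def ..
  have D: "(\<Sum>v\<in>S. real (degree V E v)) = (\<Sum>x\<in>V. real (i x))"
  proof -
    have "real (i x) = (\<Sum>v\<in>S. ind ({x,v} \<in> E))" for x
      using sum.inter_filter[OF fS, of "\<lambda>_. 1::real" "\<lambda>v. {v,x} \<in> E"]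
      by (simp add: i_def ind_def insert_commute)
    thus ?thesis unfolding degree_def nbrs_def cc by (simp only:) (rule sum.swap)
  qed
  have full: "i x = s \<longleftrightarrow> (\<forall>u\<in>S. {u,x} \<in> E)" for x
  proof
    assume "i x = s"
    hence "{v\<in>S. {v,x} \<in> E} = S"
      using assms(2) fS by (intro card_subset_eq) (auto simp: i_def)
    thus "\<forall>u\<in>S. {u,x} \<in> E" by blast
  next
    assume "\<forall>u\<in>S. {u,x} \<in> E"
    hence "{v\<in>S. {v,x} \<in> E} = S" by blast
    thus "i x = s" using assms(2) by (simp add: i_def)
  qed
  have ile: "i x \<le> s" for x unfolding i_def assms(2)[symmetric] using fS by (auto intro: card_mono)
  \<comment> \<open>If \<open>x\<close> misses exactly one vertex \<open>v0\<close> of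
    \<open>S\<close>, then it becomes a common neighbour only when \<open>v0\<close> is
    removed.\<close>
  have one: "h x = 1" if "i x + 1 = s" for x
  proof -
    have "card (S - {v\<in>S. {v,x} \<in> E}) = 1"
      using that assms(2) fS by (subst card_Diff_subset) (auto simp: i_def)
    then obtain v0 where v0: "S - {v\<in>S. {v,x} \<in> E} = {v0}" by (auto simp: card_1_singleton_iff)
    have "(\<forall>u\<in>S-{v}. {u,x} \<in> E) \<longleftrightarrow> v = v0" if "v \<in> S" for v
      using v0 that by blast
    moreover have "v0 \<in> S" using v0 by blast
    ultimately have "h x = (\<Sum>v\<in>S. ind (v = v0))" unfolding h_def by (intro sum.cong) auto
    also have "\<dots> = 1" using fS \<open>v0 \<in> S\<close> by (simp add: ind_def)
    finally show ?thesis .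
  qed
  have all: "h x = s" if "i x = s" for x
  proof -
    have "h x = (\<Sum>v\<in>S. 1)" unfolding h_def using that full[of x]
      by (intro sum.cong) (auto simp: ind_def)
    thus ?thesis using assms(2) by simp
  qed
  have w: "w x = ind (i x = s)" for x by (simp add: w_def full)
  have h0: "h x \<ge> 0" for x by (simp add: h_def ind_def sum_nonneg)
  \<comment> \<open>Equality holds when \<open>x\<close> misses at most one vertex of
    \<open>S\<close>. When it misses two or more, the right side is at most 0.\<close>
  have ge: "h x \<ge> real (i x) - (real s - 2) + (real s - 2) * w x" for x
  proof -
    consider "i x = s" | "i x + 1 = s" | "i x + 2 \<le> s" using ile[of x] by linarith
    thus ?thesis
      by cases (use one[of x] all[of x] w[of x] h0[of x] in \<open>auto simp: ind_def\<close>)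
  qed
  have R: "(\<Sum>v\<in>S. real (degree V E v)) - (real s - 2) * real (card V) + (real s - 2) * real (card (cnbrs V E S))
     = (\<Sum>x\<in>V. real (i x) - (real s - 2) + (real s - 2) * w x)"
    unfolding D W by (simp add: sum.distrib sum_subtractf sum_distrib_left)
  show "(\<Sum>v\<in>S. real (card (cnbrs V E (S - {v})))) \<ge>
      (\<Sum>v\<in>S. real (degree V E v)) - (real s - 2) * real (card V) + (real s - 2) * real (card (cnbrs V E S))"
    unfolding R L by (rule sum_mono) (rule ge)
  assume as: "\<And>x. x \<in> V \<Longrightarrow> s \<le> card {v\<in>S. {v,x} \<in> E} + 2"
  have ge: "h x = real (i x) - (real s - 2) + (real s - 2) * w x" if "x \<in> V" for x
  proof -
    have s2: "s \<le> i x + 2" using as[OF that] by (simp add: i_def)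
    then consider "i x = s" | "i x + 1 = s" | "i x + 2 = s" using ile[of x] by linarith
    thus ?thesis
    proof cases
      case 3
      \<comment> \<open>Removing a single vertex cannot repair two missing adjacencies, so
        \<open>h x = 0\<close>; the right side is 0 as well because exactly two are missing.\<close>
      have "card {v\<in>S. {v,x} \<in> E} < card (S - {v})" if "v \<in> S" for v
        using that fS assms(2) 3 by (simp add: i_def)
      moreover have "card (S - {v}) \<le> card {v\<in>S. {v,x} \<in> E}" if "\<forall>u\<in>S-{v}. {u,x} \<in> E" for v
        using that fS by (intro card_mono) auto
      ultimately have "ind (\<forall>u\<in>S-{v}. {u,x} \<in> E) = 0" if "v \<in> S" for v
        unfolding ind_def using that by (meson leD)
      hence "h x = 0" by (simp add: h_def)
      thus ?thesis using 3 w[of x] by (auto simp: ind_def)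
    qed (use one[of x] all[of x] w[of x] in \<open>auto simp: ind_def\<close>)
  qed
  show "(\<Sum>v\<in>S. real (card (cnbrs V E (S - {v})))) =
      (\<Sum>v\<in>S. real (degree V E v)) - (real s - 2) * real (card V) + (real s - 2) * real (card (cnbrs V E S))"
    unfolding R L by (rule sum.cong) (simp_all add: ge)
qed

end

section \<open>Codegree bounds and the gap identity under a minimum degree condition\<close>

locale clique_free_graph = fin_graph V E for V :: "'a set" and E +
  fixes b p :: nat
  assumes degree_ge: "v \<in> V \<Longrightarrow> card V \<le> degree V E v + b"
    and no_clique: "cliques (p+2) V E = {}"
begin

abbreviation D :: "'a set \<Rightarrow> real" where "D T \<equiv> real (card (cnbrs V E T))"
abbreviation n :: real where "n \<equiv> real (card V)"
abbreviation k :: "nat \<Rightarrow> real" where "k t \<equiv> real (kcl t V E)"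

text \<open>Adding \<open>v\<close> to \<open>T\<close> loses only non-neighbours of
  \<open>v\<close>, of which there are at most \<open>b\<close>, counting \<open>v\<close>
  itself.\<close>

lemma card_cnbrs_insert:
  assumes "v \<in> V"
  shows "card (cnbrs V E T) \<le> card (cnbrs V E (insert v T)) + b"
proof -
  have "card (cnbrs V E T) \<le> card (cnbrs V E (insert v T) \<union> (V - nbrs V E v))"
    using cnbrs_insert_superset finite_V by (intro card_mono) auto
  also have "\<dots> \<le> card (cnbrs V E (insert v T)) + card (V - nbrs V E v)"
    by (rule card_Un_le)
  finally show ?thesis using card_non_nbrs[of v] degree_ge[OF assms] by linarith
qed

lemma cnbrs_ge:
  assumes "T \<in> cliques t V E"
  shows "D T \<ge> n - real t * real b"
proof -
  have "card V \<le> card (cnbrs V E T) + card T * b" if "finite T" "T \<subseteq> V" for T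
    using that
  proof (induction T rule: finite_induct)
    case empty
    then show ?case by (simp add: cnbrs_def)
  next
    case (insert v T)
    then show ?case using card_cnbrs_insert[of v T] by auto
  qed
  from this[of T] have "card V \<le> card (cnbrs V E T) + t * b"
    using assms cliquesD[OF assms] clique_finite[of T] by (auto simp: clique_def)
  hence "real (card V) \<le> real (card (cnbrs V E T) + t * b)" by (simp only: of_nat_le_iff)
  thus ?thesis by simp
qed

text \<open>A \<open>(p+1)\<close>-clique has no common neighbour. Going down from there, each
  removed vertex raises the codegree by at most \<open>b\<close>; the induction runs on
  \<open>m = p + 1 - t\<close>.\<close>

lemma cnbrs_le:
  assumes "T \<in> cliques t V E" "t \<le> p + 1"
  shows "D T \<le> (real p + 1 - real t) * real b"
proof -
  have "t + m = p + 1 \<Longrightarrow> T \<in> cliques t V E \<Longrightarrow> card (cnbrs V E T) \<le> m * b" for m t T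
  proof (induction m arbitrary: t T)
    case 0
    have "cnbrs V E T = {}"
      using insert_cliques[OF 0(2)] no_clique 0(1) by auto
    thus ?case by simp
  next
    case (Suc m)
    show ?case
    proof (cases "cnbrs V E T = {}")
      case False
      then obtain v where v: "v \<in> cnbrs V E T" by auto
      hence "v \<in> V" by (simp add: cnbrs_def)
      moreover have "card (cnbrs V E (insert v T)) \<le> m * b"
        using Suc.IH[OF _ insert_cliques[OF Suc.prems(2) v]] Suc.prems(1) by simp
      ultimately show ?thesis using card_cnbrs_insert[of v T] by simp
    qed simp
  qed
  from this[of t "p + 1 - t" T] assms have "card (cnbrs V E T) \<le> (p + 1 - t) * b" by simp
  hence "real (card (cnbrs V E T)) \<le> real ((p + 1 - t) * b)" by (simp only: of_nat_le_iff)
  also have "\<dots> = (real p + 1 - real t) * real b" using assms(2) by (simp add: of_nat_diff)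
  finally show ?thesis .
qed

text \<open>The two gaps are the slacks of the two basic inequalities, for a \<open>t\<close>-clique \<open>T\<close> and for a clique \<open>S\<close>.\<close>
definition codegree_gap :: "nat \<Rightarrow> 'a set \<Rightarrow> real" where
  "codegree_gap t T = (D T - (n - real t * real b)) * ((real p + 1 - real t) * real b - D T)"

definition facet_gap :: "'a set \<Rightarrow> real" where
  "facet_gap S = (\<Sum>v\<in>S. D (S - {v})) - (2 * n - real (card S) * real b) - (real (card S) - 2) * D S"

lemma codegree_gap_nonneg: "T \<in> cliques t V E \<Longrightarrow> t \<le> p + 1 \<Longrightarrow> 0 \<le> codegree_gap t T"
  unfolding codegree_gap_def using cnbrs_ge[of T t] cnbrs_le[of T t] by simp

lemma degree_real_ge: "v \<in> V \<Longrightarrow> n - real b \<le> real (degree V E v)"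
  using degree_ge[of v] by linarith

text \<open>The degrees are kept explicit instead of being replaced by \<open>n - b\<close>, so that
  a vanishing gap forces every vertex of \<open>S\<close> to have minimum degree.\<close>

lemma facet_gap_ge:
  assumes "S \<in> cliques s V E"
  shows "facet_gap S \<ge> (\<Sum>v\<in>S. real (degree V E v) - (n - real b))"
  using sum_card_cnbrs_remove_ge[OF cliquesD(1)[OF assms] refl]
  unfolding facet_gap_def by (simp add: sum_subtractf sum.distrib algebra_simps)

lemma facet_gap_nonneg: "S \<in> cliques s V E \<Longrightarrow> 0 \<le> facet_gap S"
  using cliquesD(1)[of S s]
  by (intro order_trans[OF sum_nonneg facet_gap_ge]) (auto simp: clique_def degree_real_ge)

lemma facet_gap_eq_0D:
  assumes "S \<in> cliques s V E" "facet_gap S = 0" "v \<in> S"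
  shows "real (degree V E v) = n - real b"
proof -
  have SV: "S \<subseteq> V" "finite S" using cliquesD(1)[OF assms(1)] clique_finite[of S] by (auto simp: clique_def)
  have nn: "0 \<le> real (degree V E u) - (n - real b)" if "u \<in> S" for u
    using degree_real_ge[of u] SV that by auto
  have "(\<Sum>v\<in>S. real (degree V E v) - (n - real b)) = 0"
    using facet_gap_ge[OF assms(1)] sum_nonneg[of S "\<lambda>v. real (degree V E v) - (n - real b)"] nn assms(2)
    by fastforce
  thus ?thesis using sum_nonneg_eq_0_iff[OF SV(2) nn] assms(3) by auto
qed

text \<open>Expanding the codegree gaps gives minus the sum of \<open>D T * D T\<close>. By
  \<open>sum_extensions\<close> this cancels the facet sums \<open>X\<close> in the facet gaps,
  leaving an expression linear in three consecutive clique counts.\<close>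

lemma gap_identity:
  assumes "t \<ge> 1"
  shows "(\<Sum>T\<in>cliques t V E. codegree_gap t T) + (\<Sum>S\<in>cliques (t+1) V E. facet_gap S)
    = ((real t - 1) * n + real (t+1) * (real p + 2 - 2 * real t) * real b) * k (t+1)
      - (n - real t * real b) * (real p + 1 - real t) * real b * k t - (real t - 1) * real (t+2) * k (t+2)"
proof -
  define lo where "lo = n - real t * real b"
  define hi where "hi = (real p + 1 - real t) * real b"
  define X where "X = (\<Sum>S\<in>cliques (t+1) V E. \<Sum>v\<in>S. D (S - {v}))"
  have e: "codegree_gap t T = (lo + hi) * D T - D T * D T - lo * hi" for T
    unfolding codegree_gap_def lo_def hi_def by (simp add: algebra_simps)
  have "(\<Sum>T\<in>cliques t V E. codegree_gap t T) = (lo + hi) * (\<Sum>T\<in>cliques t V E. D T) 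
      - (\<Sum>T\<in>cliques t V E. D T * D T) - k t * (lo * hi)"
    unfolding e by (simp add: sum_subtractf sum_distrib_left kcl_eq_card_cliques)
  also have "\<dots> = (lo + hi) * real (t+1) * k (t+1) - X - k t * (lo * hi)"
    unfolding sum_card_cnbrs X_def using sum_extensions[where t = t and f = D] by simp
  finally have 1: "(\<Sum>T\<in>cliques t V E. codegree_gap t T) = (lo + hi) * real (t+1) * k (t+1) - X - k t * (lo * hi)" .
  have "(\<Sum>S\<in>cliques (t+1) V E. facet_gap S) = (\<Sum>S\<in>cliques (t+1) V E.
     (\<Sum>v\<in>S. D (S - {v})) - (2 * n - real (t+1) * real b) - (real (t+1) - 2) * D S)"
    by (rule sum.cong) (auto simp: facet_gap_def dest: cliquesD)
  also have "\<dots> = X - k (t+1) * (2 * n - real (t+1) * real b) - (real (t+1) - 2) * (\<Sum>S\<in>cliques (t+1) V E. D S)"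
    unfolding X_def by (simp add: sum_subtractf sum_distrib_left kcl_eq_card_cliques)
  also have "\<dots> = X - k (t+1) * (2 * n - real (t+1) * real b) - (real (t+1) - 2) * (real (t+2) * k (t+2))"
    unfolding sum_card_cnbrs by (simp add: numeral_eq_Suc)
  finally show ?thesis unfolding 1 lo_def hi_def by (simp add: algebra_simps)
qed

end

section \<open>The ratio chain\<close>

text \<open>Writing \<open>p = Suc q\<close> makes \<open>q\<close> the number of independent
  classes in the extremal graph. The assumption \<open>dense\<close> is the inequality
  \<open>p * beta < 1\<close> multiplied by the order of the graph.\<close>

locale dense_clique_free_graph = clique_free_graph V E b "Suc q"
  for V :: "'a set" and E b q +
  assumes b_pos: "0 < b" and dense: "Suc q * b < card V"
begin

abbreviation G :: "nat \<Rightarrow> real" where "G j \<equiv> Gpoly q n (real b) j"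

definition ratio :: "nat \<Rightarrow> real" where "ratio j = k (j+2) / G j"

definition gaps :: "nat \<Rightarrow> real" where
  "gaps t = (\<Sum>T\<in>cliques t V E. codegree_gap t T) + (\<Sum>S\<in>cliques (t+1) V E. facet_gap S)"

lemma gaps_nonneg: "t \<le> Suc q + 1 \<Longrightarrow> 0 \<le> gaps t"
  unfolding gaps_def
  by (intro add_nonneg_nonneg sum_nonneg) (auto simp: codegree_gap_nonneg facet_gap_nonneg)

lemma gaps_eq_0_iff:
  assumes "t \<le> Suc q + 1"
  shows "gaps t = 0 \<longleftrightarrow> (\<forall>T\<in>cliques t V E. codegree_gap t T = 0) \<and> (\<forall>S\<in>cliques (t+1) V E. facet_gap S = 0)"
proof -
  have "0 \<le> codegree_gap t T" if "T \<in> cliques t V E" for T using codegree_gap_nonneg[OF that assms] .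
  moreover have "0 \<le> facet_gap S" if "S \<in> cliques (t+1) V E" for S using facet_gap_nonneg[OF that] .
  ultimately show ?thesis
    unfolding gaps_def by (simp add: add_nonneg_eq_0_iff sum_nonneg sum_nonneg_eq_0_iff)
qed

lemma dense_real: "real (Suc q) * real b < n"
  using dense by (metis of_nat_less_iff of_nat_mult)

lemma G_pos: "j \<le> q \<Longrightarrow> 0 < G j"
  using Gpoly_pos[of j q "real b" n] b_pos dense_real by simp

lemma k_eq_ratio: "j \<le> q \<Longrightarrow> k (j+2) = ratio j * G j"
  using G_pos[of j] by (simp add: ratio_def)

text \<open>Index \<open>q + 1\<close> corresponds to cliques of size \<open>p + 2\<close>. Both
  sequences stop there, so \<open>ratio j\<close> is a meaningful quotient only for
  \<open>j <= q\<close>.\<close>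

lemma top_vanishes: "k (q+3) = 0" "G (q+1) = 0"
  using no_clique by (simp_all add: kcl_eq_card_cliques Gpoly_def binomial_eq_0 numeral_eq_Suc)

definition cA :: "nat \<Rightarrow> real" where "cA j = (n - real (j+2) * real b) * (real q - real j) * real b"
definition cB :: "nat \<Rightarrow> real" where
  "cB j = real (j+1) * n + real (j+3) * (real q - 1 - 2 * real j) * real b"
definition cC :: "nat \<Rightarrow> real" where "cC j = real (j+1) * real (j+4)"

lemma cC_pos: "0 < cC j"
  by (simp add: cC_def)

lemma cA_pos: "j < q \<Longrightarrow> 0 < cA j"
proof -
  assume j: "j < q"
  hence "real (j+2) * real b \<le> real (Suc q) * real b"
    by (intro mult_right_mono) auto
  hence "0 < n - real (j+2) * real b" using dense_real by linarith
  thus ?thesis unfolding cA_def using b_pos j by (intro mult_pos_pos) auto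
qed

lemma k_recurrence: "cA j * k (j+2) + cC j * k (j+4) + gaps (j+2) = cB j * k (j+3)"
  using gap_identity[of "j+2"] unfolding gaps_def cA_def cB_def cC_def
  by (simp add: numeral_eq_Suc algebra_simps)

lemma G_recurrence: "cA j * G j + cC j * G (j+2) = cB j * G (j+1)"
  using Gpoly_recurrence[of n j "real b" q] unfolding cA_def cB_def cC_def .

text \<open>Subtracting \<open>ratio (j+1)\<close> times the recurrence for \<open>G\<close> from
  the one for \<open>k\<close> cancels the terms with \<open>cB\<close>, because
  \<open>k (j+3) = ratio (j+1) * G (j+1)\<close>.\<close>

lemma ratio_recurrence:
  assumes "j < q"
  shows "cA j * G j * (ratio (j+1) - ratio j) = cC j * (k (j+4) - ratio (j+1) * G (j+2)) + gaps (j+2)"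
proof -
  have "k (j+2) = ratio j * G j" "k (j+3) = ratio (j+1) * G (j+1)"
    using k_eq_ratio[of j] k_eq_ratio[of "j+1"] assms by (simp_all add: numeral_eq_Suc)
  thus ?thesis using k_recurrence[of j] G_recurrence[of j] by algebra
qed

text \<open>The top index is separate because \<open>ratio (q+1)\<close> would have denominator
  zero; there both terms of the excess vanish.\<close>

lemma k_excess:
  assumes "j < q"
  shows "k (j+4) - ratio (j+1) * G (j+2) = (if j + 1 = q then 0 else (ratio (j+2) - ratio (j+1)) * G (j+2))"
proof (cases "j + 1 = q")
  case True
  hence j: "j + 4 = q + 3" "j + 2 = q + 1" by auto
  show ?thesis unfolding j top_vanishes using True by simp
next
  case False
  thus ?thesis using k_eq_ratio[of "j+2"] assms by (simp add: numeral_eq_Suc algebra_simps)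
qed

lemma cAG_cancel: "j < q \<Longrightarrow> 0 \<le> cA j * G j * x \<Longrightarrow> 0 \<le> x"
  using cA_pos[of j] G_pos[of j] by (auto simp: zero_le_mult_iff mult_le_0_iff)

text \<open>Downward induction on \<open>j\<close>, with \<open>m\<close> the distance of
  \<open>j\<close> from \<open>q - 1\<close>. At the top only the nonnegative gaps remain in
  \<open>ratio_recurrence\<close>; further down the inequality for \<open>j + 1\<close> makes the
  excess nonnegative.\<close>

lemma ratio_step:
  assumes "j < q"
  shows "ratio j \<le> ratio (j+1)"
proof -
  have "j < q \<Longrightarrow> ratio j \<le> ratio (j+1)" if "q = j + Suc m" for m j
    using that
  proof (induction m arbitrary: j)
    case 0
    hence "0 \<le> cA j * G j * (ratio (j+1) - ratio j)"
      using ratio_recurrence[of j] k_excess[of j] gaps_nonneg[of "j+2"] by simp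
    from cAG_cancel[OF _ this] show ?case using 0 by simp
  next
    case (Suc m)
    have "ratio (j+1) \<le> ratio (j+2)" using Suc.IH[of "j+1"] Suc.prems by simp
    hence "0 \<le> (ratio (j+2) - ratio (j+1)) * G (j+2)" using G_pos[of "j+2"] Suc.prems by simp
    hence "0 \<le> cA j * G j * (ratio (j+1) - ratio j)"
      using ratio_recurrence[of j] k_excess[of j] gaps_nonneg[of "j+2"] cC_pos[of j] Suc.prems by simp
    from cAG_cancel[OF _ this] show ?case using Suc.prems by simp
  qed
  from this[of j "q - j - 1"] show ?thesis using assms by simp
qed

lemma ratio_mono: "i \<le> j \<Longrightarrow> j \<le> q \<Longrightarrow> ratio i \<le> ratio j"
proof (induction rule: dec_induct)
  case (step m)
  thus ?case using ratio_step[of m] by simp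
qed simp

text \<open>With \<open>ratio j = ratio (j+1)\<close> the left side of
  \<open>ratio_recurrence\<close> is 0, so the two nonnegative terms on its right both
  vanish.\<close>

lemma ratio_eq_propagates:
  assumes "j + 1 < q" "ratio j = ratio (j+1)"
  shows "ratio (j+1) = ratio (j+2)"
proof -
  have "cC j * ((ratio (j+2) - ratio (j+1)) * G (j+2)) \<le> 0"
    using ratio_recurrence[of j] k_excess[of j] gaps_nonneg[of "j+2"] assms by simp
  hence "ratio (j+2) - ratio (j+1) \<le> 0"
    using cC_pos[of j] G_pos[of "j+2"] assms(1) by (simp add: mult_le_0_iff)
  thus ?thesis using ratio_step[of "j+1"] assms(1) by simp
qed

text \<open>Monotonicity squeezes the pair to the neighbours \<open>i\<close> and
  \<open>i + 1\<close>, and propagation carries equality up to \<open>q - 1\<close> and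
  \<open>q\<close>. There \<open>ratio_recurrence\<close> consists of the gaps alone.\<close>

lemma ratio_eq_top_gaps:
  assumes "i < j" "j \<le> q" "ratio i = ratio j"
  shows "gaps (Suc q) = 0"
proof -
  have i: "ratio i = ratio (i+1)"
    using ratio_mono[of i "i+1"] ratio_mono[of "i+1" j] assms by simp
  have "i \<le> l \<Longrightarrow> l < q \<Longrightarrow> ratio l = ratio (l+1)" for l
  proof (induction rule: dec_induct)
    case (step m)
    thus ?case using ratio_eq_propagates[of m] by simp
  qed (simp add: i)
  from this[of "q-1"] have "ratio (q-1) = ratio (q-1+1)" using assms by simp
  moreover have "q-1 < q" "q-1+1=q" "q-1+2=Suc q" using assms by auto
  ultimately show ?thesis using ratio_recurrence[of "q-1"] k_excess[of "q-1"] by simp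
qed

lemma ratio_eq_of_gaps:
  assumes "\<And>j. j < q \<Longrightarrow> gaps (j+2) = 0" "j \<le> q"
  shows "ratio j = ratio q"
proof -
  have "q = j + m \<Longrightarrow> ratio j = ratio q" for m j
  proof (induction m arbitrary: j)
    case (Suc m)
    have "ratio (j+1) = ratio q" using Suc.IH[of "j+1"] Suc.prems by simp
    \<comment> \<open>The induction hypothesis speaks about \<open>j + 1\<close> only; the value at
      \<open>j + 2\<close> is squeezed between those at \<open>j + 1\<close> and
      \<open>q\<close>.\<close>
    moreover have "j + 1 \<noteq> q \<Longrightarrow> ratio (j+2) = ratio (j+1)"
    proof -
      assume "j + 1 \<noteq> q"
      then obtain l where "m = Suc l" using Suc.prems by (cases m) auto
      thus "ratio (j+2) = ratio (j+1)"
        using Suc.IH[of "j+1"] Suc.prems ratio_mono[of "j+1" "j+2"] ratio_mono[of "j+2" q] by simp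
    qed
    ultimately have "cA j * G j * (ratio (j+1) - ratio j) = 0"
      using ratio_recurrence[of j] k_excess[of j] assms(1)[of j] Suc.prems by simp
    thus ?case using cA_pos[of j] G_pos[of j] Suc.prems \<open>ratio (j+1) = ratio q\<close> by simp
  qed simp
  from this[of j "q-j"] show ?thesis using assms(2) by simp
qed

text \<open>Greedy extension: a clique of size at most \<open>q + 1\<close> has at least
  \<open>n - Suc q * b > 0\<close> common neighbours.\<close>

lemma cliques_nonempty: "t \<le> q + 2 \<Longrightarrow> cliques t V E \<noteq> {}"
proof (induction t)
  case 0
  have "{} \<in> cliques 0 V E" by (simp add: cliques_def clique_def)
  thus ?case by auto
next
  case (Suc t)
  then obtain T where T: "T \<in> cliques t V E" by auto
  have "real t * real b \<le> real (Suc q) * real b" using Suc.prems by (intro mult_right_mono) auto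
  hence "D T > 0" using cnbrs_ge[OF T] dense_real by linarith
  hence "cnbrs V E T \<noteq> {}" by auto
  thus ?case using insert_cliques[OF T] by blast
qed

end

section \<open>The extremal structure\<close>

text \<open>A subtraction-free form of feasibility together with membership in the family:
  triangle-minimality of the part \<open>P 0\<close> is replaced by triangle-freeness, and its size
  follows from \<open>disjoint_parts_card\<close>.\<close>

definition extremal_partition :: "'a set \<Rightarrow> 'a set set \<Rightarrow> nat \<Rightarrow> nat \<Rightarrow> (nat \<Rightarrow> 'a set) \<Rightarrow> bool" where
  "extremal_partition V E b p P \<longleftrightarrow>
     (\<Union>i<p. P i) = V \<and> (\<forall>i<p. \<forall>j<p. i \<noteq> j \<longrightarrow> P i \<inter> P j = {}) \<and>
     (\<forall>i. 1 \<le> i \<and> i < p \<longrightarrow> card (P i) = b) \<and>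
     (\<forall>i<p. \<forall>j<p. i \<noteq> j \<longrightarrow> (\<forall>u\<in>P i. \<forall>v\<in>P j. {u, v} \<in> E)) \<and>
     (\<forall>i. 1 \<le> i \<and> i < p \<longrightarrow> (\<forall>u\<in>P i. \<forall>v\<in>P i. {u, v} \<notin> E)) \<and>
     (\<forall>v\<in>P 0. degree (P 0) (induced E (P 0)) v + p * b = card V) \<and>
     kcl 3 (P 0) (induced E (P 0)) = 0"

lemma extremal_partitionD:
  assumes "extremal_partition V E b p P"
  shows "(\<Union>i<p. P i) = V"
    and "\<And>i j. i < p \<Longrightarrow> j < p \<Longrightarrow> i \<noteq> j \<Longrightarrow> P i \<inter> P j = {}"
    and "\<And>i. 1 \<le> i \<Longrightarrow> i < p \<Longrightarrow> card (P i) = b"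
    and "\<And>i j u v. i < p \<Longrightarrow> j < p \<Longrightarrow> i \<noteq> j \<Longrightarrow> u \<in> P i \<Longrightarrow> v \<in> P j \<Longrightarrow> {u, v} \<in> E"
    and "\<And>i u v. 1 \<le> i \<Longrightarrow> i < p \<Longrightarrow> u \<in> P i \<Longrightarrow> v \<in> P i \<Longrightarrow> {u, v} \<notin> E"
    and "\<And>v. v \<in> P 0 \<Longrightarrow> degree (P 0) (induced E (P 0)) v + p * b = card V"
    and "kcl 3 (P 0) (induced E (P 0)) = 0"
  using assms unfolding extremal_partition_def by (elim conjE; simp)+

lemma disjoint_parts_card:
  fixes P :: "nat \<Rightarrow> 'a set"
  assumes "finite V" "(\<Union>i<p. P i) = V" "\<And>i j. i < p \<Longrightarrow> j < p \<Longrightarrow> i \<noteq> j \<Longrightarrow> P i \<inter> P j = {}"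
    and "\<And>i. 1 \<le> i \<Longrightarrow> i < p \<Longrightarrow> card (P i) = b" "p = Suc q"
  shows "card (P 0) + q * b = card V"
proof -
  have fin: "finite (P i)" if "i < p" for i using assms(1,2) that by (auto intro: finite_subset)
  have "card V = (\<Sum>i<p. card (P i))"
    unfolding assms(2)[symmetric] by (rule card_UN_disjoint) (use fin assms(3) in auto)
  also have "\<dots> = card (P 0) + (\<Sum>i<q. card (P (Suc i)))"
    unfolding assms(5) by (rule sum.lessThan_Suc_shift)
  also have "(\<Sum>i<q. card (P (Suc i))) = (\<Sum>i<q. b)"
    using assms(4,5) by (intro sum.cong) auto
  finally show ?thesis by simp
qed

context fin_graph begin

lemma nbrs_induced: "v \<in> W \<Longrightarrow> nbrs W (induced E W) v = nbrs V E v \<inter> W"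
  using edge_ends by (auto simp: nbrs_def induced_def)

lemma clique_induced: "W \<subseteq> V \<Longrightarrow> clique W (induced E W) S \<longleftrightarrow> clique V E S \<and> S \<subseteq> W"
  by (auto simp: clique_def induced_def)

lemma triangle_free_induced:
  assumes "W \<subseteq> V"
  shows "kcl 3 W (induced E W) = 0 \<longleftrightarrow> (\<forall>S. clique V E S \<and> S \<subseteq> W \<longrightarrow> card S \<noteq> 3)"
proof -
  have "finite {S. clique W (induced E W) S \<and> card S = 3}"
    by (rule finite_subset[OF _ finite_cliques[of 3]]) (auto simp: clique_induced[OF assms] cliques_def)
  thus ?thesis unfolding kcl_def clique_induced[OF assms] by auto
qed

end

context dense_clique_free_graph begin

text \<open>Every vertex has exactly \<open>b\<close> non-neighbours (itself included), all in its
  own part, and a clique meets no part in more than two vertices. This makes all facet gaps vanish,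
  and \<open>D T\<close> is the lower or the upper bound according to whether \<open>T\<close> has
  at most one or exactly two vertices in \<open>P 0\<close>.\<close>

lemma extremal_imp_gaps:
  assumes P: "extremal_partition V E b (Suc q) P" and t: "1 \<le> t" "t \<le> Suc q"
  shows "gaps t = 0"
proof -
  have cover: "(\<Union>i<Suc q. P i) = V"
    and disj: "\<And>i j. i < Suc q \<Longrightarrow> j < Suc q \<Longrightarrow> i \<noteq> j \<Longrightarrow> P i \<inter> P j = {}"
    and card_P: "\<And>i. 1 \<le> i \<Longrightarrow> i < Suc q \<Longrightarrow> card (P i) = b"
    and compl: "\<And>i j u v. i < Suc q \<Longrightarrow> j < Suc q \<Longrightarrow> i \<noteq> j \<Longrightarrow> u \<in> P i \<Longrightarrow> v \<in> P j \<Longrightarrow> {u, v} \<in> E"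
    and indep: "\<And>i u v. 1 \<le> i \<Longrightarrow> i < Suc q \<Longrightarrow> u \<in> P i \<Longrightarrow> v \<in> P i \<Longrightarrow> {u, v} \<notin> E"
    and reg: "\<And>v. v \<in> P 0 \<Longrightarrow> degree (P 0) (induced E (P 0)) v + Suc q * b = card V"
    and tri: "kcl 3 (P 0) (induced E (P 0)) = 0"
    by (fact extremal_partitionD[OF P])+
  have PV: "P i \<subseteq> V" if "i < Suc q" for i using cover that by blast
  hence finP: "finite (P i)" if "i < Suc q" for i using that finite_V finite_subset by blast
  have card0: "card (P 0) + q * b = card V"
    using disjoint_parts_card[OF finite_V cover disj card_P refl] by blast
  define part where "part v = (THE i. i < Suc q \<and> v \<in> P i)" for v
  have part_eq: "part v = i" if "i < Suc q" "v \<in> P i" for v i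
    unfolding part_def
  proof (rule the_equality)
    show "j = i" if "j < Suc q \<and> v \<in> P j" for j
      using disj[of i j] that \<open>i < Suc q\<close> \<open>v \<in> P i\<close> by blast
  qed (use that in blast)
  have part: "part v < Suc q \<and> v \<in> P (part v)" if "v \<in> V" for v
  proof -
    from that cover obtain i where "i < Suc q" "v \<in> P i" by blast
    thus ?thesis using part_eq[of i v] by simp
  qed
  define N where "N v = V - nbrs V E v" for v
  have N_sub: "N v \<subseteq> P (part v)" if "v \<in> V" for v
  proof
    fix x assume x: "x \<in> N v"
    hence "x \<in> V" "{x, v} \<notin> E" by (auto simp: N_def nbrs_def)
    thus "x \<in> P (part v)" using part[of x] part[OF that] compl[of "part x" "part v" x v] by fastforce
  qed
  have N_pos: "N v = P (part v)" if "v \<in> V" "part v \<noteq> 0" for v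
    using N_sub[OF that(1)] part[OF that(1)] PV[of "part v"] indep[of "part v" _ v] that(2)
    unfolding N_def nbrs_def by fastforce
  have card_N: "card (N v) = b" if v: "v \<in> V" for v
  proof (cases "part v = 0")
    case True
    hence v0: "v \<in> P 0" using part[OF v] by simp
    \<comment> \<open>Here the count is \<open>(n - q * b) - (n - Suc q * b) = b\<close>.\<close>
    have "N v = P 0 - (nbrs V E v \<inter> P 0)" using N_sub[OF v] True PV[of 0] by (auto simp: N_def)
    hence "card (N v) = card (P 0) - degree (P 0) (induced E (P 0)) v"
      using finP[of 0] by (simp add: degree_def nbrs_induced[OF v0] card_Diff_subset)
    thus ?thesis using reg[OF v0] card0 by simp
  next
    case False
    thus ?thesis using N_pos[OF v] part[OF v] card_P[of "part v"] by simp
  qed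
  have degree_eq: "real (degree V E v) = n - real b" if "v \<in> V" for v
    using card_N[OF that] card_non_nbrs[of v] by (simp add: N_def)
  have two: "card (S \<inter> P i) \<le> 2" if S: "clique V E S" and i: "i < Suc q" for S i
  proof (rule ccontr)
    assume "\<not> ?thesis"
    hence "3 \<le> card (S \<inter> P i)" by simp
    from obtain_subset_with_card_n[OF this] obtain W where W: "W \<subseteq> S \<inter> P i" "card W = 3" by blast
    show False
    proof (cases "i = 0")
      case True
      thus ?thesis using tri triangle_free_induced[OF PV[of 0]] W clique_subset[OF S, of W] by auto
    next
      case False
      obtain u v where uv: "u \<in> W" "v \<in> W" "u \<noteq> v"
        using W(2) by (metis card_3_iff insertI1 insertI2)
      hence "{u, v} \<in> E" "u \<in> P i" "v \<in> P i" using S W(1) by (auto simp: clique_def)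
      thus ?thesis using indep[of i u v] i False by simp
    qed
  qed
  have vg: "facet_gap S = 0" if S: "S \<in> cliques s V E" for S s
  proof -
    have cS: "clique V E S" "finite S" "S \<subseteq> V"
      using cliquesD(1)[OF S] clique_finite[of S] by (auto simp: clique_def)
    have "card S \<le> card {v\<in>S. {v,x} \<in> E} + 2" if "x \<in> V" for x
    proof -
      \<comment> \<open>The vertices of \<open>S\<close> missed by \<open>x\<close> share its part,
        so there are at most two of them: the condition for equality in
        \<open>sum_card_cnbrs_remove_eq\<close>.\<close>
      have "S - {v\<in>S. {v,x} \<in> E} \<subseteq> S \<inter> P (part x)"
        using N_sub[OF that] cS(3) by (auto simp: N_def nbrs_def)
      hence "card (S - {v\<in>S. {v,x} \<in> E}) \<le> 2"
        using two[OF cS(1), of "part x"] part[OF that] cS(2)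
        by (meson card_mono finite_Int order_trans)
      thus ?thesis using cS(2) by (simp add: card_Diff_subset)
    qed
    from sum_card_cnbrs_remove_eq[OF cS(1) refl this]
    have "facet_gap S = (\<Sum>v\<in>S. real (degree V E v)) - real (card S) * (n - real b)"
      unfolding facet_gap_def by (simp add: algebra_simps)
    also have "(\<Sum>v\<in>S. real (degree V E v)) = (\<Sum>v\<in>S. n - real b)"
      using cS(3) degree_eq by (intro sum.cong) auto
    finally show ?thesis by simp
  qed
  have eg: "codegree_gap t T = 0" if T: "T \<in> cliques t V E" for T
  proof -
    have cT: "clique V E T" "finite T" "T \<subseteq> V" "card T = t"
      using cliquesD[OF T] clique_finite[of T] by (auto simp: clique_def)
    have compl_T: "V - cnbrs V E T = (\<Union>v\<in>T. N v)"
      by (auto simp: cnbrs_def N_def nbrs_def insert_commute)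
    have cnT: "card (V - cnbrs V E T) + card (cnbrs V E T) = card V"
      using finite_V card_mono[of V "cnbrs V E T"]
      by (subst card_Diff_subset) (auto simp: cnbrs_def)
    have part_inj: "part u \<noteq> part v" if "u \<in> T" "v \<in> T" "u \<noteq> v" "u \<notin> P 0" for u v
    proof
      assume eq: "part u = part v"
      have uv: "u \<in> V" "v \<in> V" "{u, v} \<in> E" using that cT(1,3) by (auto simp: clique_def)
      have "part u \<noteq> 0"
      proof
        assume "part u = 0"
        thus False using part[OF uv(1)] that(4) by simp
      qed
      thus False using indep[of "part u" u v] part[OF uv(1)] part[OF uv(2)] eq uv(3) by simp
    qed
    have disjN: "N u \<inter> N v = {}" if "u \<in> T" "v \<in> T" "u \<noteq> v" "u \<notin> P 0" for u v
      using part_inj[OF that] N_sub[of u] N_sub[of v] part[of u] part[of v] disj[of "part u" "part v"] that cT(3)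
      by blast
    have finN: "finite (N v)" for v using finite_V by (simp add: N_def)
    show ?thesis
    proof (cases "card (T \<inter> P 0) \<le> 1")
      case True
      have "u \<notin> P 0 \<or> v \<notin> P 0" if "u \<in> T" "v \<in> T" "u \<noteq> v" for u v
      proof (rule ccontr)
        assume "\<not> ?thesis"
        hence "card {u, v} \<le> card (T \<inter> P 0)" using that cT(2) by (intro card_mono) auto
        thus False using True that(3) by simp
      qed
      \<comment> \<open>The vertices of \<open>T\<close> lie in distinct parts, so their
        non-neighbourhoods are disjoint and \<open>D T\<close> is the lower bound.\<close>
      hence "card (\<Union>v\<in>T. N v) = (\<Sum>v\<in>T. card (N v))"
        using cT(2) finN disjN by (intro card_UN_disjoint) (auto simp: Int_commute, metis Int_commute disjoint_iff)
      also have "\<dots> = t * b" using card_N cT by (simp add: subset_eq)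
      finally have "t * b + card (cnbrs V E T) = card V" using compl_T cnT by simp
      hence "real (t * b + card (cnbrs V E T)) = n" by simp
      hence "D T = n - real t * real b" by simp
      thus ?thesis by (simp add: codegree_gap_def)
    next
      case False
      hence c2: "card (T \<inter> P 0) = 2" using two[OF cT(1), of 0] by simp
      \<comment> \<open>A vertex of \<open>P 0\<close> adjacent to both members of \<open>T\<close>
        in \<open>P 0\<close> would complete a triangle. Hence all of \<open>P 0\<close> is lost,
        besides \<open>b\<close> vertices for each of the other \<open>t - 2\<close> members, and
        \<open>D T\<close> is the upper bound.\<close>
      have "P 0 \<subseteq> (\<Union>v\<in>T. N v)"
      proof
        fix x assume x: "x \<in> P 0"
        show "x \<in> (\<Union>v\<in>T. N v)"
        proof (rule ccontr)
          assume "x \<notin> (\<Union>v\<in>T. N v)"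
          hence "x \<in> cnbrs V E T" using compl_T x PV[of 0] by auto
          hence "clique V E (insert x T)" "x \<notin> T" using clique_insert cT(1) cnbrs_notin by auto
          hence "clique V E (insert x (T \<inter> P 0))" "x \<notin> T \<inter> P 0"
            using clique_subset[of "insert x T" "insert x (T \<inter> P 0)"] by auto
          moreover from this have "card (insert x (T \<inter> P 0)) = 3" using c2 cT(2) by simp
          ultimately show False using tri triangle_free_induced[OF PV[of 0]] x by auto
        qed
      qed
      moreover have "N v \<subseteq> P 0" if "v \<in> T" "v \<in> P 0" for v
        using N_sub[of v] part_eq[of 0 v] that cT(3) by auto
      ultimately have U: "(\<Union>v\<in>T. N v) = P 0 \<union> (\<Union>v\<in>T - P 0. N v)" by auto
      have "P 0 \<inter> N v = {}" if "v \<in> T - P 0" for v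
      proof -
        have v: "v \<in> V" "v \<notin> P 0" using that cT(3) by auto
        have "part v \<noteq> 0" using part[OF v(1)] v(2) by metis
        hence "P 0 \<inter> P (part v) = {}" using disj[of 0 "part v"] part[OF v(1)] by simp
        thus ?thesis using N_sub[OF v(1)] by blast
      qed
      hence "P 0 \<inter> (\<Union>v\<in>T - P 0. N v) = {}" by blast
      moreover have "finite (\<Union>v\<in>T - P 0. N v)" using finN cT(2) by blast
      ultimately have "card (\<Union>v\<in>T. N v) = card (P 0) + card (\<Union>v\<in>T - P 0. N v)"
        unfolding U using finP[of 0] by (intro card_Un_disjoint) simp_all
      also have "card (\<Union>v\<in>T - P 0. N v) = (\<Sum>v\<in>T - P 0. card (N v))"
        using cT(2) finN disjN by (intro card_UN_disjoint) auto
      also have "\<dots> = (\<Sum>v\<in>T - P 0. b)" using card_N cT(3) by (intro sum.cong) auto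
      also have "\<dots> = card (T - P 0) * b" by simp
      also have "card (T - P 0) = t - 2"
        using c2 cT(2,4) by (metis card_Diff_subset_Int finite_Int)
      finally have "card (P 0) + (t - 2) * b + card (cnbrs V E T) = card V" using compl_T cnT by simp
      hence "(t - 2) * b + card (cnbrs V E T) = q * b" using card0 by simp
      moreover have "2 \<le> t" using c2 cT(2,4) card_mono[of T "T \<inter> P 0"] by simp
      then obtain m where m: "t = m + 2" using le_Suc_ex by (metis add.commute)
      ultimately have "real (m * b + card (cnbrs V E T)) = real (q * b)" by simp
      hence "D T = (real (Suc q) + 1 - real t) * real b" by (simp add: m algebra_simps)
      thus ?thesis by (simp add: codegree_gap_def)
    qed
  qed
  show ?thesis using gaps_eq_0_iff[of t] t vg eg by simp
qed

end

section \<open>Recovering the partition from vanishing gaps at the top\<close>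

context dense_clique_free_graph begin

lemma no_extension: "S \<in> cliques (q+2) V E \<Longrightarrow> cnbrs V E S = {}"
  using insert_cliques[of S "q+2"] no_clique by auto

lemma top_clique_degree:
  assumes "gaps (Suc q) = 0" "S \<in> cliques (q+2) V E" "v \<in> S"
  shows "degree V E v + b = card V"
proof -
  have "S \<in> cliques (Suc q + 1) V E" using assms(2) by simp
  hence "facet_gap S = 0" using assms(1) gaps_eq_0_iff[of "Suc q"] by auto
  from facet_gap_eq_0D[OF assms(2) this assms(3)] show ?thesis by linarith
qed

text \<open>Each facet of a \<open>(p+1)\<close>-clique has codegree \<open>lo\<close> or
  \<open>b\<close>, the two ends of the interval for \<open>t = p\<close>, and the codegrees sum to
  \<open>2 * lo + q * b\<close>. So exactly \<open>q\<close> of them equal \<open>b\<close>, unless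
  \<open>lo = b\<close> and all do.\<close>

lemma small_facets:
  assumes "gaps (Suc q) = 0" "S \<in> cliques (q+2) V E"
  shows "q \<le> card {v\<in>S. card (cnbrs V E (S - {v})) = b}"
proof -
  define J where "J = {v\<in>S. card (cnbrs V E (S - {v})) = b}"
  define lo where "lo = n - real (Suc q) * real b"
  have fS: "finite S" and cS: "card S = q + 2"
    using cliquesD[OF assms(2)] clique_finite[of S] by auto
  have S': "S \<in> cliques (Suc q + 1) V E" using assms(2) by simp
  have D: "D (S - {v}) = lo \<or> D (S - {v}) = real b" if "v \<in> S" for v
  proof -
    have "S - {v} \<in> cliques (Suc q) V E" using remove_cliques[of S "Suc q" v] assms(2) that by simp
    hence "codegree_gap (Suc q) (S - {v}) = 0" using assms(1) gaps_eq_0_iff[of "Suc q"] by auto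
    thus ?thesis by (auto simp: codegree_gap_def lo_def)
  qed
  have "facet_gap S = 0" using assms(1) gaps_eq_0_iff[of "Suc q"] S' by auto
  hence sum: "(\<Sum>v\<in>S. D (S - {v})) = 2 * n - real (q+2) * real b"
    using no_extension[OF assms(2)] cS by (simp add: facet_gap_def)
  have "real (card J) * real b + real (q + 2 - card J) * lo = (\<Sum>v\<in>J. D (S - {v})) + (\<Sum>v\<in>S-J. D (S - {v}))"
  proof -
    have "card (S - J) = q + 2 - card J" using cS fS by (simp add: J_def card_Diff_subset)
    moreover have "(\<Sum>v\<in>S-J. D (S - {v})) = (\<Sum>v\<in>S-J. lo)"
      using D by (intro sum.cong) (auto simp: J_def)
    ultimately show ?thesis by (simp add: J_def)
  qed
  also have "\<dots> = (\<Sum>v\<in>S. D (S - {v}))"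
    using sum.subset_diff[of J S "\<lambda>v. D (S - {v})"] fS by (simp add: J_def)
  finally have eq: "real (card J) * real b + real (q + 2 - card J) * lo = 2 * n - real (q+2) * real b"
    unfolding sum .
  have le: "card J \<le> q + 2" unfolding cS[symmetric] J_def using fS by (auto intro: card_mono)
  have "(real (card J) - real q) * (real b - lo) = 0"
    using eq le by (simp add: lo_def of_nat_diff algebra_simps)
  moreover have "lo = real b \<Longrightarrow> J = S" using D by (auto simp: J_def)
  ultimately have "q \<le> card J" using cS by auto
  thus ?thesis by (simp add: J_def)
qed

text \<open>A single \<open>(p+1)\<close>-clique \<open>S\<close> determines the partition:
  \<open>q\<close> of its facets with codegree \<open>b\<close> provide the independent classes
  \<open>Q v\<close>, and the remaining vertices form \<open>P 0\<close>.\<close>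

lemma gaps_imp_extremal:
  assumes top: "gaps (Suc q) = 0"
  shows "\<exists>P. extremal_partition V E b (Suc q) P"
proof -
  obtain S where S: "S \<in> cliques (q+2) V E" using cliques_nonempty[of "q+2"] by auto
  have cS: "clique V E S" "finite S" "S \<subseteq> V" "card S = q + 2"
    using cliquesD[OF S] clique_finite[of S] by (auto simp: clique_def)
  from obtain_subset_with_card_n[OF small_facets[OF top S]]
  obtain J where J: "J \<subseteq> {v\<in>S. card (cnbrs V E (S - {v})) = b}" "card J = q" "finite J" by blast
  define Q where "Q v = cnbrs V E (S - {v})" for v
  have JS: "v \<in> S" if "v \<in> J" for v using J that by auto
  have card_Q: "card (Q v) = b" if "v \<in> J" for v using J that by (auto simp: Q_def)
  have Q_V: "Q v \<subseteq> V" for v by (auto simp: Q_def cnbrs_def)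
  have fQ: "finite (Q v)" for v by (simp add: Q_def)
  have self_Q: "v \<in> Q v" if "v \<in> J" for v
    using clique_remove[OF cS(1) JS[OF that]] by (simp add: Q_def)
  \<comment> \<open>Exchanging \<open>v\<close> for \<open>u\<close> gives another top clique, so
    \<open>u\<close> has degree \<open>n - b\<close>. An edge inside \<open>Q v\<close> would create
    a clique on \<open>p + 2\<close> vertices; hence the neighbourhood of \<open>u\<close> lies in
    \<open>V - Q v\<close>, and it has the same size.\<close>
  have nbrs_Q: "nbrs V E u = V - Q v" if v: "v \<in> J" and u: "u \<in> Q v" for u v
  proof -
    have "S - {v} \<in> cliques (q+1) V E" using remove_cliques[of S "q+1" v] S JS[OF v] by simp
    hence ins: "insert u (S - {v}) \<in> cliques (q+2) V E"
      using insert_cliques[of "S - {v}" "q+1" u] u by (simp add: Q_def)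
    have "w \<notin> Q v" if "w \<in> nbrs V E u" for w
    proof
      assume "w \<in> Q v"
      hence "w \<in> cnbrs V E (insert u (S - {v}))"
        using that by (auto simp: Q_def cnbrs_def nbrs_def insert_commute)
      thus False using no_extension[OF ins] by simp
    qed
    hence sub: "nbrs V E u \<subseteq> V - Q v" by (auto simp: nbrs_def)
    have "degree V E u + b = card V" using top_clique_degree[OF top ins] by simp
    hence "card (nbrs V E u) = card (V - Q v)"
      using card_Q[OF v] Q_V[of v] fQ[of v] by (simp add: degree_def card_Diff_subset)
    thus ?thesis using sub finite_V by (intro card_subset_eq) auto
  qed
  have Q_disj: "Q v \<inter> Q w = {}" if "v \<noteq> w" for v w
  proof -
    have "Q v \<inter> Q w \<subseteq> cnbrs V E S" using that by (auto simp: Q_def cnbrs_def)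
    thus ?thesis using no_extension[OF S] by auto
  qed
  define U where "U = (\<Union>v\<in>J. Q v)"
  have U_V: "U \<subseteq> V" using Q_V by (auto simp: U_def)
  have card_U: "card U = q * b"
  proof -
    have "card U = (\<Sum>v\<in>J. card (Q v))" unfolding U_def
      using J(3) fQ Q_disj by (intro card_UN_disjoint) auto
    thus ?thesis using card_Q J(2) by simp
  qed
  have adj: "{u, x} \<in> E" "{x, u} \<in> E" if "v \<in> J" "u \<in> Q v" "x \<in> V" "x \<notin> Q v" for u v x
    using nbrs_Q[OF that(1,2)] that(3,4) by (auto simp: nbrs_def insert_commute)
  \<comment> \<open>The set \<open>J\<close> is a clique with one vertex in each class, so it
    extends any clique outside \<open>U\<close> by \<open>q\<close> vertices.\<close>
  have join: "W \<union> J \<in> cliques (card W + q) V E" if W: "clique V E W" "W \<subseteq> V - U" for W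
  proof -
    have notQ: "x \<notin> Q v" if "x \<in> W" "v \<in> J" for x v using W(2) that by (auto simp: U_def)
    have "{u, v} \<in> E" if "u \<in> W \<union> J" "v \<in> W \<union> J" "u \<noteq> v" for u v
    proof -
      have WV: "w \<in> V" if "w \<in> W" for w using W(2) that by auto
      consider "u \<in> W" "v \<in> W" | "u \<in> J" "v \<in> J" | "u \<in> W" "v \<in> J" | "u \<in> J" "v \<in> W"
        using \<open>u \<in> W \<union> J\<close> \<open>v \<in> W \<union> J\<close> by blast
      thus ?thesis
      proof cases
        case 1
        thus ?thesis using W(1) \<open>u \<noteq> v\<close> by (auto simp: clique_def)
      next
        case 2
        thus ?thesis using cS(1) JS \<open>u \<noteq> v\<close> by (auto simp: clique_def)
      next
        case 3
        thus ?thesis using adj(2)[of v v u] self_Q notQ WV by auto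
      next
        case 4
        thus ?thesis using adj(1)[of u u v] self_Q notQ WV by auto
      qed
    qed
    moreover have "W \<union> J \<subseteq> V" using W(2) JS cS(3) by auto
    moreover have "W \<inter> J = {}" using notQ self_Q by blast
    ultimately show ?thesis using clique_finite[OF W(1)] J(2,3)
      by (auto simp: cliques_def clique_def card_Un_disjoint)
  qed
  have card_inner: "card (nbrs V E v \<inter> (V - U)) + q * b = degree V E v" if v: "v \<in> V - U" for v
  proof -
    have "U \<subseteq> nbrs V E v"
      using v adj(1)[of _ _ v] U_V by (auto simp: U_def nbrs_def)
    moreover have "finite (nbrs V E v)" using finite_V by (simp add: nbrs_def)
    moreover have "nbrs V E v \<inter> (V - U) = nbrs V E v - U" by (auto simp: nbrs_def)
    ultimately show ?thesis unfolding degree_def card_U[symmetric]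
      using card_mono[of "nbrs V E v" U] by (simp add: card_Diff_subset finite_subset)
  qed
  have inner_degree: "card (nbrs V E v \<inter> (V - U)) + Suc q * b = card V" if v: "v \<in> V - U" for v
  proof -
    \<comment> \<open>Degrees are known only on top cliques. By \<open>dense\<close>,
      \<open>v\<close> has a neighbour outside \<open>U\<close>, and this edge together with
      \<open>J\<close> is a top clique.\<close>
    have "card (nbrs V E v \<inter> (V - U)) > 0"
      using card_inner[OF v] degree_ge[of v] v dense by (intro Nat.gr0I) auto
    then obtain u where u: "u \<in> nbrs V E v" "u \<in> V - U" by (metis card_gt_0_iff ex_in_conv IntE)
    hence uv: "u \<noteq> v" "{u,v} \<in> E" "u \<in> V" using not_loop by (auto simp: nbrs_def)
    hence "clique V E {u, v}" using v by (auto simp: clique_def insert_commute)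
    hence "{u, v} \<union> J \<in> cliques (q + 2) V E" using join[of "{u,v}"] u v uv by simp
    from top_clique_degree[OF top this, of v] show ?thesis using card_inner[OF v] by simp
  qed
  obtain f where f: "bij_betw f {1..q} J" using ex_bij_betw_nat_finite_1[OF J(3)] J(2) by auto
  have fJ: "f i \<in> J" if "1 \<le> i" "i < Suc q" for i using f that by (auto simp: bij_betw_def)
  define P where "P i = (if i = 0 then V - U else Q (f i))" for i :: nat
  have P0: "P 0 = V - U" by (simp add: P_def)
  have PS: "P i = Q (f i)" if "1 \<le> i" for i using that by (auto simp: P_def)
  have U_P: "U = (\<Union>i\<in>{1..q}. P i)"
    using f by (auto simp: U_def P_def bij_betw_def)
  have part_cases: "(i = 0 \<and> P i = V - U) \<or> (1 \<le> i \<and> P i = Q (f i) \<and> f i \<in> J)" if "i < Suc q" for i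
    using that fJ[of i] by (auto simp: P_def)
  have Q_U: "Q (f i) \<subseteq> U" if "1 \<le> i" "i < Suc q" for i using fJ[OF that] by (auto simp: U_def)
  have disj: "P i \<inter> P j = {}" if ij: "i < Suc q" "j < Suc q" "i \<noteq> j" for i j
  proof -
    consider "i = 0" "1 \<le> j" | "j = 0" "1 \<le> i" | "1 \<le> i" "1 \<le> j"
      using ij(3) by (cases "i = 0"; cases "j = 0") auto
    thus ?thesis
    proof cases
      case 1
      have "P j \<subseteq> U" using Q_U[of j] ij(2) PS[of j] 1(2) by simp
      thus ?thesis using P0 1(1) by blast
    next
      case 2
      have "P i \<subseteq> U" using Q_U[of i] ij(1) PS[of i] 2(2) by simp
      thus ?thesis using P0 2(1) by blast
    next
      case 3
      hence "f i \<noteq> f j" using inj_on_eq_iff[OF bij_betw_imp_inj_on[OF f], of i j] ij by simp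
      thus ?thesis using Q_disj[of "f i" "f j"] PS 3 by simp
    qed
  qed
  have PV: "P i \<subseteq> V" for i using Q_V by (auto simp: P_def)
  have "(\<Union>i<Suc q. P i) = V"
  proof
    show "V \<subseteq> (\<Union>i<Suc q. P i)"
    proof
      fix x assume x: "x \<in> V"
      show "x \<in> (\<Union>i<Suc q. P i)"
      proof (cases "x \<in> U")
        case True
        then obtain i where "i \<in> {1..q}" "x \<in> P i" using U_P by blast
        thus ?thesis by (intro UN_I[of i]) auto
      next
        case False
        thus ?thesis using x P0 by (intro UN_I[of 0]) auto
      qed
    qed
  qed (use PV in auto)
  moreover have "card (P i) = b" if "1 \<le> i" "i < Suc q" for i
    using PS[OF that(1)] card_Q[OF fJ[OF that]] by simp
  moreover have "{u, v} \<in> E" if ij: "i < Suc q" "j < Suc q" "i \<noteq> j" "u \<in> P i" "v \<in> P j" for i j u v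
  proof -
    have "u \<in> V" "v \<in> V" "u \<notin> P j" "v \<notin> P i" using disj[OF ij(1-3)] ij(4,5) PV by auto
    thus ?thesis using part_cases[OF ij(1)] part_cases[OF ij(2)] adj(1)[of "f i" u v] adj(2)[of "f j" v u] ij
      by auto
  qed
  moreover have "{u, v} \<notin> E" if "1 \<le> i" "i < Suc q" "u \<in> P i" "v \<in> P i" for i u v
    using nbrs_Q[OF fJ[OF that(1,2)], of u] that PS[OF that(1)] PV[of i]
    by (auto simp: nbrs_def insert_commute)
  moreover have "degree (P 0) (induced E (P 0)) v + Suc q * b = card V" if "v \<in> P 0" for v
    using inner_degree[of v] that nbrs_induced[OF that] unfolding P0 degree_def by simp
  moreover have "kcl 3 (P 0) (induced E (P 0)) = 0"
  proof -
    have "card W \<noteq> 3" if W: "clique V E W" "W \<subseteq> P 0" for W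
    proof
      assume "card W = 3"
      \<comment> \<open>A triangle outside \<open>U\<close> plus the \<open>q\<close> vertices of
        \<open>J\<close> would have \<open>p + 2\<close> vertices.\<close>
      hence "W \<union> J \<in> cliques (Suc q + 2) V E" using join[OF W(1)] W(2) P0 by (simp add: numeral_eq_Suc)
      thus False using no_clique by simp
    qed
    thus ?thesis using triangle_free_induced[OF PV[of 0]] by blast
  qed
  ultimately have "extremal_partition V E b (Suc q) P"
    unfolding extremal_partition_def using disj by blast
  thus ?thesis by blast
qed

end

section \<open>Transport of graphs along injective maps\<close>

definition relabel :: "('a \<Rightarrow> 'b) \<Rightarrow> 'a set set \<Rightarrow> 'b set set" where
  "relabel f E = (\<lambda>e. f ` e) ` E"

context fin_graph begin

lemma graph_relabel:
  assumes "inj_on f V"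
  shows "graph (f ` V) (relabel f E)"
proof -
  have "card (f ` e) = 2" if "e \<in> E" for e
    using that graph card_image[OF inj_on_subset[OF assms, of e]] by (simp add: graph_def)
  moreover have "f ` e \<subseteq> f ` V" if "e \<in> E" for e
    using that graph by (auto simp: graph_def)
  ultimately show ?thesis using finite_V by (auto simp: graph_def relabel_def)
qed

lemma edge_relabel_iff:
  assumes "inj_on f V" "u \<in> V" "v \<in> V"
  shows "{f u, f v} \<in> relabel f E \<longleftrightarrow> {u, v} \<in> E"
proof
  assume "{f u, f v} \<in> relabel f E"
  then obtain e where e: "e \<in> E" "f ` {u, v} = f ` e" by (auto simp: relabel_def)
  have "e \<subseteq> V" using e(1) graph by (simp add: graph_def)
  hence "{u, v} = e" using inj_on_image_eq_iff[OF assms(1), of "{u, v}" e] e(2) assms(2,3) by simp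
  thus "{u, v} \<in> E" using e(1) by simp
next
  assume "{u, v} \<in> E"
  hence "f ` {u, v} \<in> relabel f E" unfolding relabel_def by (rule imageI)
  thus "{f u, f v} \<in> relabel f E" by simp
qed

lemma degree_relabel:
  assumes "inj_on f V" "v \<in> V"
  shows "degree (f ` V) (relabel f E) (f v) = degree V E v"
proof -
  have "nbrs (f ` V) (relabel f E) (f v) = f ` nbrs V E v"
    using edge_relabel_iff[OF assms(1) _ assms(2)] by (auto simp: nbrs_def)
  moreover have "inj_on f (nbrs V E v)"
    by (rule inj_on_subset[OF assms(1)]) (auto simp: nbrs_def)
  ultimately show ?thesis by (simp add: degree_def card_image)
qed

lemma clique_relabel_iff:
  assumes "inj_on f V" "S \<subseteq> V"
  shows "clique (f ` V) (relabel f E) (f ` S) \<longleftrightarrow> clique V E S"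
proof -
  have "f u = f v \<longleftrightarrow> u = v" "{f u, f v} \<in> relabel f E \<longleftrightarrow> {u, v} \<in> E" if "u \<in> S" "v \<in> S" for u v
    using that assms edge_relabel_iff[OF assms(1), of u v] inj_on_eq_iff[OF assms(1), of u v] by auto
  thus ?thesis using assms(2) by (simp add: clique_def image_mono)
qed

lemma kcl_relabel:
  assumes "inj_on f V"
  shows "kcl r (f ` V) (relabel f E) = kcl r V E"
proof -
  have "{S. clique (f ` V) (relabel f E) S \<and> card S = r} = (\<lambda>S. f ` S) ` {S. clique V E S \<and> card S = r}"
    (is "?L = ?R")
  proof
    show "?L \<subseteq> ?R"
    proof
      fix S assume S: "S \<in> ?L"
      hence "S \<subseteq> f ` V" by (simp add: clique_def)
      then obtain T where T: "T \<subseteq> V" "S = f ` T" by (auto simp: subset_image_iff)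
      hence "card T = r" "clique V E T"
        using S clique_relabel_iff[OF assms T(1)] card_image[OF inj_on_subset[OF assms T(1)]] by auto
      thus "S \<in> ?R" using T(2) by blast
    qed
    show "?R \<subseteq> ?L"
    proof
      fix S assume "S \<in> ?R"
      then obtain T where T: "clique V E T" "card T = r" "S = f ` T" by blast
      have TV: "T \<subseteq> V" using T(1) by (simp add: clique_def)
      show "S \<in> ?L"
        using T clique_relabel_iff[OF assms TV] card_image[OF inj_on_subset[OF assms TV]] by simp
    qed
  qed
  moreover have "inj_on (\<lambda>S. f ` S) {S. clique V E S \<and> card S = r}"
    by (rule inj_on_subset[OF inj_on_image_Pow[OF assms]]) (auto simp: clique_def)
  ultimately show ?thesis by (simp add: kcl_def card_image)
qed

lemma fin_graph_induced: "W \<subseteq> V \<Longrightarrow> fin_graph W (induced E W)"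
  using graph finite_V by unfold_locales (auto simp: graph_def induced_def intro: finite_subset)

text \<open>The definitions quantify the competing graphs over initial segments of the naturals.\<close>
lemma initial_segment_copy:
  assumes "regular V E \<delta>"
  obtains H where "graph {0..<card V} H" "regular {0..<card V} H \<delta>" "kcl 3 {0..<card V} H = kcl 3 V E"
proof -
  obtain f where "bij_betw f V {0..<card V}" using ex_bij_betw_finite_nat[OF finite_V] by blast
  hence f: "inj_on f V" "f ` V = {0..<card V}" by (auto simp: bij_betw_def)
  have "regular (f ` V) (relabel f E) \<delta>"
    using assms degree_relabel[OF f(1)] by (simp add: regular_def)
  thus thesis using that[of "relabel f E"] graph_relabel[OF f(1)] kcl_relabel[OF f(1)] f(2) by simp
qed

end

section \<open>Regularity of extremal graphs and the handshake identity\<close>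

context dense_clique_free_graph begin

text \<open>Every vertex lies in an edge, and the vanishing facet gap of that edge fixes its
  degree.\<close>

lemma extremal_degree:
  assumes "extremal_partition V E b (Suc q) P" "v \<in> V"
  shows "degree V E v + b = card V"
proof -
  have "gaps 1 = 0" using extremal_imp_gaps[OF assms(1), of 1] by simp
  hence vg: "facet_gap S = 0" if "S \<in> cliques 2 V E" for S
    using gaps_eq_0_iff[of 1] that by (simp add: numeral_eq_Suc)
  have "0 < degree V E v" using degree_ge[OF assms(2)] dense by (intro Nat.gr0I) simp
  then obtain u where "u \<in> nbrs V E v" by (auto simp: degree_def card_gt_0_iff)
  hence "{u, v} \<in> E" "u \<in> V" "u \<noteq> v" using not_loop by (auto simp: nbrs_def)
  hence "{u, v} \<in> cliques 2 V E" using assms(2) by (auto simp: cliques_def clique_def insert_commute)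
  hence "real (degree V E v) = n - real b" using facet_gap_eq_0D[of "{u, v}" 2 v] vg by simp
  thus ?thesis by linarith
qed

end

context fin_graph begin

text \<open>Double counting at sizes 0 and 1. It supplies the parity condition in
  \<open>family_defined\<close>.\<close>

lemma handshake:
  assumes "\<And>v. v \<in> V \<Longrightarrow> degree V E v = d"
  shows "card V * d = 2 * kcl 2 V E"
proof -
  have "S \<in> cliques 0 V E \<longleftrightarrow> S = {}" for S
    using clique_finite[of S] by (auto simp: cliques_def clique_def)
  hence "cliques 0 V E = {{}}" by blast
  hence k1: "real (kcl 1 V E) = real (card V)" using sum_card_cnbrs[of 0] by (simp add: cnbrs_def)
  have "card (cnbrs V E T) = d" if T: "T \<in> cliques 1 V E" for T
  proof -
    have "card T = 1" "T \<subseteq> V" using T by (auto simp: cliques_def clique_def)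
    then obtain v where "T = {v}" "v \<in> V" by (auto simp: card_1_singleton_iff)
    thus ?thesis using assms degree_eq_card_cnbrs[of v] by simp
  qed
  hence "(\<Sum>T\<in>cliques 1 V E. real (card (cnbrs V E T))) = real (kcl 1 V E) * real d"
    by (simp add: kcl_eq_card_cliques)
  hence "real (card V) * real d = 2 * real (kcl 2 V E)"
    using sum_card_cnbrs[of 1] k1 by (simp add: numeral_2_eq_2)
  hence "real (card V * d) = real (2 * kcl 2 V E)" by simp
  thus ?thesis by (simp only: of_nat_eq_iff)
qed

end

context dense_clique_free_graph begin

text \<open>A triangle-free \<open>P 0\<close> is a triangle-minimal regular graph and forces all
  other minimisers to be triangle-free. Conversely, feasibility applied to a copy of the graph on
  \<open>P 0\<close> shows that it has no triangle.\<close>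

lemma extremal_iff_family:
  assumes \<beta>: "real b = \<beta> * n" and pp: "pp \<beta> = Suc q"
  shows "(\<exists>P. extremal_partition V E b (Suc q) P) \<longleftrightarrow> feasible (card V) \<beta> \<and> in_family V E (card V) \<beta>"
proof
  have expand: "real x = (1 - c * \<beta>) * n \<longleftrightarrow> real x + c * real b = n" for x c
    by (simp add: \<beta> eq_diff_eq left_diff_distrib mult.assoc)
  have nat_iff: "real x + real m * real b = n \<longleftrightarrow> x + m * b = card V" for x m
    by (simp only: of_nat_eq_iff of_nat_add[symmetric] of_nat_mult[symmetric])
  have q: "real (Suc q) - 1 = real q" by simp
  have c0: "real x = (1 - (real (Suc q) - 1) * \<beta>) * n \<longleftrightarrow> x + q * b = card V" for x
    unfolding q expand nat_iff ..
  have dg: "real x = (1 - real (Suc q) * \<beta>) * n \<longleftrightarrow> x + Suc q * b = card V" for x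
    unfolding expand nat_iff ..
  {
    assume "\<exists>P. extremal_partition V E b (Suc q) P"
    then obtain P where P: "extremal_partition V E b (Suc q) P" by blast
    have cover: "(\<Union>i<Suc q. P i) = V"
      and disj: "\<And>i j. i < Suc q \<Longrightarrow> j < Suc q \<Longrightarrow> i \<noteq> j \<Longrightarrow> P i \<inter> P j = {}"
      and card_P: "\<And>i. 1 \<le> i \<Longrightarrow> i < Suc q \<Longrightarrow> card (P i) = b"
      and reg: "\<And>v. v \<in> P 0 \<Longrightarrow> degree (P 0) (induced E (P 0)) v + Suc q * b = card V"
      and tri: "kcl 3 (P 0) (induced E (P 0)) = 0"
      by (fact extremal_partitionD[OF P])+
    have card0: "card (P 0) + q * b = card V"
      using disjoint_parts_card[OF finite_V cover disj card_P refl] by blast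
    have P0V: "P 0 \<subseteq> V" using cover by blast
    have regular: "regular (P 0) (induced E (P 0)) ((1 - real (Suc q) * \<beta>) * n)"
      using reg dg by (simp add: regular_def)
    have bV: "b < card V" using dense by simp
    have deg: "degree V E v = card V - b" if "v \<in> V" for v
      using extremal_degree[OF P that] by simp
    have "even (card V * (card V - b))" using handshake[OF deg] by simp
    hence fam: "family_defined (card V) \<beta>"
      unfolding family_defined_def using bV \<beta>
      by (intro conjI exI[of _ "card V - b"]) (auto simp: of_nat_diff algebra_simps)
    interpret P0: fin_graph "P 0" "induced E (P 0)" by (rule fin_graph_induced[OF P0V])
    obtain H0 where H0: "graph {0..<card (P 0)} H0"
        "regular {0..<card (P 0)} H0 ((1 - real (Suc q) * \<beta>) * n)"
        "kcl 3 {0..<card (P 0)} H0 = kcl 3 (P 0) (induced E (P 0))"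
      using P0.initial_segment_copy[OF regular] by blast
    \<comment> \<open>The copy \<open>H0\<close> is a triangle-free competitor on the same vertex
      set, so a minimiser \<open>H\<close> has no triangle either.\<close>
    have "kcl 3 {0..<m} H = 0"
      if "real m = (1 - (real (Suc q) - 1) * \<beta>) * n"
        "min_tri_regular {0..<m} H ((1 - real (Suc q) * \<beta>) * n)" for m H
    proof -
      have "real m = real (card (P 0))" using that(1) c0[of "card (P 0)"] card0 by simp
      hence "m = card (P 0)" by simp
      thus ?thesis using that(2) H0 tri unfolding min_tri_regular_def by auto
    qed
    hence "feasible (card V) \<beta>" unfolding feasible_def pp using fam by blast
    moreover have "in_family V E (card V) \<beta>"
      unfolding in_family_def pp Let_def
    proof (intro conjI exI[of _ P])
      show "real (card (P 0)) = (1 - (real (Suc q) - 1) * \<beta>) * n" using c0 card0 by simp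
      show "\<forall>i. 1 \<le> i \<and> i < Suc q \<longrightarrow> real (card (P i)) = \<beta> * n" using card_P \<beta> by simp
      show "min_tri_regular (P 0) (induced E (P 0)) ((1 - real (Suc q) * \<beta>) * n)"
        unfolding min_tri_regular_def using regular tri by simp
      show "\<forall>i<Suc q. \<forall>j<Suc q. i \<noteq> j \<longrightarrow> (\<forall>u\<in>P i. \<forall>v\<in>P j. {u, v} \<in> E)"
        using P unfolding extremal_partition_def by (elim conjE)
      show "\<forall>i. 1 \<le> i \<and> i < Suc q \<longrightarrow> (\<forall>u\<in>P i. \<forall>v\<in>P i. {u, v} \<notin> E)"
        using P unfolding extremal_partition_def by (elim conjE)
    qed (use fam graph cover disj in simp_all)
    ultimately show "feasible (card V) \<beta> \<and> in_family V E (card V) \<beta>" by blast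
  }
  {
    assume as: "feasible (card V) \<beta> \<and> in_family V E (card V) \<beta>"
    hence "in_family V E (card V) \<beta>" by blast
    from this[unfolded in_family_def pp Let_def]
    obtain P where cover: "(\<Union>i<Suc q. P i) = V"
      and disj: "\<forall>i<Suc q. \<forall>j<Suc q. i \<noteq> j \<longrightarrow> P i \<inter> P j = {}"
      and card0: "real (card (P 0)) = (1 - (real (Suc q) - 1) * \<beta>) * n"
      and card_P: "\<forall>i. 1 \<le> i \<and> i < Suc q \<longrightarrow> real (card (P i)) = \<beta> * n"
      and compl: "\<forall>i<Suc q. \<forall>j<Suc q. i \<noteq> j \<longrightarrow> (\<forall>u\<in>P i. \<forall>v\<in>P j. {u, v} \<in> E)"
      and indep: "\<forall>i. 1 \<le> i \<and> i < Suc q \<longrightarrow> (\<forall>u\<in>P i. \<forall>v\<in>P i. {u, v} \<notin> E)"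
      and mtr: "min_tri_regular (P 0) (induced E (P 0)) ((1 - real (Suc q) * \<beta>) * n)"
      by - (elim conjE exE, rule that)
    have P0V: "P 0 \<subseteq> V" using cover by blast
    have reg: "regular (P 0) (induced E (P 0)) ((1 - real (Suc q) * \<beta>) * n)"
      using mtr by (simp add: min_tri_regular_def)
    interpret P0: fin_graph "P 0" "induced E (P 0)" by (rule fin_graph_induced[OF P0V])
    obtain H0 where H0: "graph {0..<card (P 0)} H0"
        "regular {0..<card (P 0)} H0 ((1 - real (Suc q) * \<beta>) * n)"
        "kcl 3 {0..<card (P 0)} H0 = kcl 3 (P 0) (induced E (P 0))"
      using P0.initial_segment_copy[OF reg] by blast
    have "min_tri_regular {0..<card (P 0)} H0 ((1 - real (Suc q) * \<beta>) * n)"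
      using mtr H0 by (simp add: min_tri_regular_def)
    hence "kcl 3 {0..<card (P 0)} H0 = 0"
      using conjunct1[OF as] card0 H0(1) unfolding feasible_def pp by simp
    hence tri: "kcl 3 (P 0) (induced E (P 0)) = 0" using H0(3) by simp
    have "\<forall>v\<in>P 0. degree (P 0) (induced E (P 0)) v + Suc q * b = card V"
      using reg dg unfolding regular_def by simp
    moreover have "\<forall>i. 1 \<le> i \<and> i < Suc q \<longrightarrow> card (P i) = b"
      using card_P unfolding \<beta>[symmetric] by simp
    ultimately have "extremal_partition V E b (Suc q) P"
      unfolding extremal_partition_def using cover disj compl indep tri by (intro conjI)
    thus "\<exists>P. extremal_partition V E b (Suc q) P" by blast
  }
qed

end

text \<open>The guard \<open>pp \<beta> \<ge> 2\<close> ensures that a pair \<open>t < s\<close> in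
  the range exists; otherwise the universal statement is vacuous while the existential one
  fails.\<close>

theorem mainTheorem6:
  fixes V :: "'a set" and E :: "'a set set" and \<beta> :: real and n d :: nat
  assumes "0 < \<beta>" and "\<beta> < 1"
    and "graph V E" and "card V = n"
    and "kcl (pp \<beta> + 2) V E = 0"
    and "min_degree_eq V E d" and "real d = (1 - \<beta>) * real n"
  shows "(\<forall>t s. 2 \<le> t \<and> t < s \<and> s \<le> pp \<beta> + 1 \<longrightarrow>
            real (kcl s V E) / (g s \<beta> * real n ^ s) \<ge> real (kcl t V E) / (g t \<beta> * real n ^ t))
      \<and> (pp \<beta> \<ge> 2 \<longrightarrow>
          ((\<exists>t s. 2 \<le> t \<and> t < s \<and> s \<le> pp \<beta> + 1 \<and>
               real (kcl s V E) / (g s \<beta> * real n ^ s) = real (kcl t V E) / (g t \<beta> * real n ^ t))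
           \<longleftrightarrow> (\<forall>t s. 2 \<le> t \<and> t < s \<and> s \<le> pp \<beta> + 1 \<longrightarrow>
               real (kcl s V E) / (g s \<beta> * real n ^ s) = real (kcl t V E) / (g t \<beta> * real n ^ t)))
        \<and> ((\<forall>t s. 2 \<le> t \<and> t < s \<and> s \<le> pp \<beta> + 1 \<longrightarrow>
               real (kcl s V E) / (g s \<beta> * real n ^ s) = real (kcl t V E) / (g t \<beta> * real n ^ t))
           \<longleftrightarrow> feasible n \<beta> \<and> in_family V E n \<beta>))"
proof (cases "pp \<beta> \<ge> 2")
  case False
  thus ?thesis by auto
next
  case True
  then obtain q where q: "pp \<beta> = Suc q" "1 \<le> q" by (cases "pp \<beta>") auto
  define b where "b = n - d"
  obtain v0 where "v0 \<in> V" using assms(6) by (auto simp: min_degree_eq_def)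
  hence n: "0 < n" using assms(3,4) by (auto simp: graph_def card_gt_0_iff)
  have "(1 - \<beta>) * real n \<le> 1 * real n" using assms(1) by (intro mult_right_mono) auto
  hence "d \<le> n" using assms(7) by simp
  hence b: "real b = \<beta> * real n" using assms(7) by (simp add: b_def of_nat_diff algebra_simps)
  \<comment> \<open>A ceiling minus one is strictly below its argument; this gives the density
    assumption.\<close>
  have "real (Suc q) < 1 / \<beta>"
  proof -
    have "real (pp \<beta>) = real_of_int (\<lceil>1 / \<beta>\<rceil> - 1)"
      using True unfolding pp_def by linarith
    thus ?thesis unfolding q by linarith
  qed
  hence "real (Suc q) * \<beta> < 1" using assms(1) by (simp add: field_simps)
  hence "real (Suc q) * \<beta> * real n < 1 * real n" using n by (intro mult_strict_right_mono) auto
  hence "real (Suc q * b) < real n" using b by (simp add: algebra_simps)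
  hence dense: "Suc q * b < n" by (simp only: of_nat_less_iff)
  interpret fin_graph V E by (unfold_locales) (rule assms(3))
  have fin: "finite (cliques (pp \<beta> + 2) V E)" by (rule finite_cliques)
  interpret dense_clique_free_graph V E b q
  proof
    show "card V \<le> degree V E v + b" if "v \<in> V" for v
      using assms(4,6) that by (force simp: min_degree_eq_def b_def)
    show "cliques (Suc q + 2) V E = {}"
      using assms(5) fin unfolding kcl_eq_card_cliques q(1) by simp
    have "0 < real b" using b n assms(1) by simp
    thus "0 < b" by simp
    show "Suc q * b < card V" using dense assms(4) by simp
  qed
  define R where "R s = real (kcl s V E) / (g s \<beta> * real n ^ s)" for s
  have R: "R s = ratio (s - 2)" if "2 \<le> s" for s
  proof -
    have "g s \<beta> * real n ^ s = Gpoly q (real n) (real b) (s - 2)"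
      using g_conv_Gpoly[OF q(1), of "real n" "s - 2", unfolded le_add_diff_inverse2[OF that]] n b by simp
    thus ?thesis unfolding R_def ratio_def le_add_diff_inverse2[OF that] using assms(4) by simp
  qed
  have mono: "R t \<le> R s" if "2 \<le> t" "t < s" "s \<le> pp \<beta> + 1" for t s
    using ratio_mono[of "t - 2" "s - 2"] that q R by simp
  let ?all = "\<forall>t s. 2 \<le> t \<and> t < s \<and> s \<le> pp \<beta> + 1 \<longrightarrow> R s = R t"
  let ?some = "\<exists>t s. 2 \<le> t \<and> t < s \<and> s \<le> pp \<beta> + 1 \<and> R s = R t"
  have 1: "\<exists>P. extremal_partition V E b (Suc q) P" if ?some
  proof -
    from that obtain t s where "2 \<le> t" "t < s" "s \<le> Suc q + 1" "R s = R t" unfolding q(1) by blast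
    hence "gaps (Suc q) = 0" using ratio_eq_top_gaps[of "t - 2" "s - 2"] R[of s] R[of t] by simp
    thus ?thesis by (rule gaps_imp_extremal)
  qed
  have 2: ?all if "\<exists>P. extremal_partition V E b (Suc q) P"
  proof -
    from that obtain P where P: "extremal_partition V E b (Suc q) P" by blast
    have top: "ratio j = ratio q" if "j \<le> q" for j
      using extremal_imp_gaps[OF P] that by (intro ratio_eq_of_gaps) auto
    have "R t = ratio q" if "2 \<le> t" "t \<le> Suc q + 1" for t
      unfolding R[OF that(1)] using that by (intro top) simp
    thus ?thesis unfolding q(1) by (metis less_imp_le less_le_trans order_trans)
  qed
  \<comment> \<open>The pair \<open>t = 2\<close>, \<open>s = 3\<close> witnesses the existential
    statement.\<close>
  have "2 \<le> (2::nat) \<and> 2 < (3::nat) \<and> 3 \<le> pp \<beta> + 1" using q by simp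
  hence 3: ?some if ?all using that by blast
  have 4: "(\<exists>P. extremal_partition V E b (Suc q) P) \<longleftrightarrow> feasible n \<beta> \<and> in_family V E n \<beta>"
    using extremal_iff_family[of \<beta>] b q(1) assms(4) by simp
  have "?some \<longleftrightarrow> ?all" "?all \<longleftrightarrow> feasible n \<beta> \<and> in_family V E n \<beta>"
    using 1 2 3 4 by argo+
  moreover have "\<forall>t s. 2 \<le> t \<and> t < s \<and> s \<le> pp \<beta> + 1 \<longrightarrow> R t \<le> R s"
    using mono by simp
  ultimately show ?thesis unfolding R_def by (intro conjI impI)
qed

end
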